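(* Let $K:\mathbb{R}_+\to\mathbb{R}_+$ be a generalized completely monotone (gCM) kernel for which $\lambda=\mathcal{L}_b^{-1}[K]\in\mathcal{M}^{(1)}_{\exp}(\mathbb{R})$, and let $c_0\in\mathbb{R}$, $c_1\ge0$. Consider the equation $$y(t)=c_1\dot x(t)-c_0x(t)-\int_0^tK(t-\tau)x(\tau)\,d\tau,\qquad x(0)=x_0\ \ (\text{if }c_1\ne0),\qquad(\ast)$$ where the source $y$ is a sufficiently regular function on $\mathbb{R}_+=[0,\infty)$. Suppose that $(\mu,\zeta_0,\zeta_1)=\mathcal{B}_{\mathbb{R}}[\lambda,c_0,c_1]$ is well-defined with $\mu\in\mathcal{M}^{(1)}_{\exp}(\mathbb{R})$, and write $J=\mathcal{L}_b[\mu]$. Then $(\ast)$ is satisfied by the function $x$ given by $$-\pi^2x(t)=\zeta_1\dot y(t)-\zeta_0y(t)-\int_0^tJ(t-\tau)y(\tau)\,d\tau-c_1x_0J(t).$$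
   Context: A smooth non-negative $F$ on $\mathbb{R}_+$ is completely monotone (CM) if $(-1)^jF^{(j)}(t)\ge0$ for all $j\ge0$ and $t>0$; $K$ is gCM if $K(t)=e^{\sigma t}F(t)$ for some CM $F$ and $\sigma\in\mathbb{R}$. By Bernstein's theorem, $K$ is gCM iff $K(t)=\mathcal{L}_b[\lambda](t)=\int e^{-\sigma t}\,d\lambda(\sigma)$ for a non-negative Borel measure $\lambda$ with $\inf\operatorname{supp}\lambda>-\infty$; one writes $\lambda=\mathcal{L}_b^{-1}[K]$. $\mathcal{M}_+^{(n)}(\mathbb{R})$ is the set of nonzero non-negative locally finite Borel measures $\lambda$ on $\mathbb{R}$ with $\int(1+s^2)^{-n/2}\,d\lambda(s)<\infty$; $\mathcal{M}^{(n)}_{\exp}(\mathbb{R})$ is the set of those with $\inf\operatorname{supp}\lambda>-\infty$. For $\lambda\in\mathcal{M}_+^{(1)}(\mathbb{R})$ and $z\in\mathbb{H}=\{\operatorname{Im}z>0\}$, $Q_{\mathbb{R}}[\lambda](z)=\int\frac{i\,d\lambda(s)}{\pi(z-s)}$. For $\lambda\in\mathcal{M}_+^{(1)}(\mathbb{R})$, $c_0\in\mathbb{R}$, $c_1\ge0$, $\mathcal{B}_{\mathbb{R}}[\lambda,c_0,c_1]=(\mu,\zeta_0,\zeta_1)$ is well-defined if there are (necessarily unique) $\mu\in\mathcal{M}_+^{(1)}(\mathbb{R})$, $\zeta_0\in\mathbb{R}$, $\zeta_1\ge0$ with $$\big(Q_{\mathbb{R}}[\lambda](z)-i\pi^{-1}c_0-i\pi^{-1}c_1z\big)\big(Q_{\mathbb{R}}[\mu](z)-i\pi^{-1}\zeta_0-i\pi^{-1}\zeta_1z\big)=1\quad\text{for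 all }z\in\mathbb{H}.$$ "Sufficiently regular" means that $y$ is regular enough for $(\ast)$ to have a classical solution $x$. *)

theory Defs
  imports "HOL-Analysis.Analysis"
begin

text \<open>
  Smoothness is required on the open half-line only, so that kernels which blow up at \<open>0\<close>
  (such as \<open>1 / sqrt t\<close>) are admitted; the values at \<open>t \<le> 0\<close> are irrelevant.
\<close>

definition completely_monotone :: "(real \<Rightarrow> real) \<Rightarrow> bool" where
  "completely_monotone F \<longleftrightarrow>
     (\<forall>j. \<forall>t>0. (deriv ^^ j) F field_differentiable (at t) \<and> 0 \<le> (-1) ^ j * (deriv ^^ j) F t)"

definition gCM :: "(real \<Rightarrow> real) \<Rightarrow> bool" where
  "gCM K \<longleftrightarrow> (\<exists>F \<sigma>. completely_monotone F \<and> (\<forall>t>0. K t = exp (\<sigma> * t) * F t))"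

definition measure_support :: "real measure \<Rightarrow> real set" where
  "measure_support \<nu> = {s. \<forall>U. open U \<and> s \<in> U \<longrightarrow> emeasure \<nu> U \<noteq> 0}"

definition M_plus :: "nat \<Rightarrow> real measure set" where
  "M_plus n = {\<nu>. sets \<nu> = sets borel \<and> emeasure \<nu> UNIV \<noteq> 0 \<and>
     (\<forall>C. compact C \<longrightarrow> emeasure \<nu> C < \<infinity>) \<and>
     (\<integral>\<^sup>+ s. ennreal ((1 + s\<^sup>2) powr (- real n / 2)) \<partial>\<nu>) < \<infinity>}"

definition M_exp :: "nat \<Rightarrow> real measure set" where
  "M_exp n = {\<nu> \<in> M_plus n. bdd_below (measure_support \<nu>)}"

text \<open>
  At \<open>t = 0\<close> the integral may diverge, and the Bochner integral then returns \<open>0\<close>.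
\<close>

definition Lb :: "real measure \<Rightarrow> real \<Rightarrow> real" where
  "Lb \<nu> t = (\<integral>\<sigma>. exp (- \<sigma> * t) \<partial>\<nu>)"

text \<open>
  The relation \<open>\<nu> = \<L>\<^sub>b\<^sup>-\<^sup>1[K]\<close>.
\<close>

definition is_Lb_inverse :: "real measure \<Rightarrow> (real \<Rightarrow> real) \<Rightarrow> bool" where
  "is_Lb_inverse \<nu> K \<longleftrightarrow> sets \<nu> = sets borel \<and> bdd_below (measure_support \<nu>) \<and>
     (\<forall>t>0. integrable \<nu> (\<lambda>\<sigma>. exp (- \<sigma> * t)) \<and> K t = Lb \<nu> t)"

definition Q_R :: "real measure \<Rightarrow> complex \<Rightarrow> complex" where
  "Q_R \<nu> z = (\<integral>s. \<i> / (of_real pi * (z - of_real s)) \<partial>\<nu>)"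

text \<open>
  The relation \<open>\<B>\<^sub>\<real>[\<nu>, c\<^sub>0, c\<^sub>1] = (\<mu>, \<zeta>\<^sub>0, \<zeta>\<^sub>1)\<close>, including that the left-hand side is well-defined.
\<close>

definition B_R :: "real measure \<Rightarrow> real \<Rightarrow> real \<Rightarrow> real measure \<Rightarrow> real \<Rightarrow> real \<Rightarrow> bool" where
  "B_R \<nu> c0 c1 \<mu> \<zeta>0 \<zeta>1 \<longleftrightarrow>
     \<nu> \<in> M_plus 1 \<and> 0 \<le> c1 \<and> \<mu> \<in> M_plus 1 \<and> 0 \<le> \<zeta>1 \<and>
     (\<forall>z. Im z > 0 \<longrightarrow>
        (Q_R \<nu> z - \<i> / of_real pi * of_real c0 - \<i> / of_real pi * of_real c1 * z) *
        (Q_R \<mu> z - \<i> / of_real pi * of_real \<zeta>0 - \<i> / of_real pi * of_real \<zeta>1 * z) = 1)"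

text \<open>
  Derivative of a function on \<open>[0, \<infinity>)\<close>, one-sided at \<open>0\<close>.
\<close>

definition ddt :: "(real \<Rightarrow> real) \<Rightarrow> real \<Rightarrow> real" where
  "ddt x t = vector_derivative x (at t within {0..})"

definition conv :: "(real \<Rightarrow> real) \<Rightarrow> (real \<Rightarrow> real) \<Rightarrow> real \<Rightarrow> real" where
  "conv K x t = (LBINT \<tau>:{0..t}. K (t - \<tau>) * x \<tau>)"

text \<open>
  The conditions under which \<open>a * ddt x t - b * x t - conv K x t\<close> makes sense classically for all
  \<open>t \<ge> 0\<close>: \<open>x\<close> is continuous, it is continuously differentiable if the derivative really occurs
  (\<open>a \<noteq> 0\<close>), and the convolution integrals converge.
\<close>

definition classically_regular :: "real \<Rightarrow> (real \<Rightarrow> real) \<Rightarrow> (real \<Rightarrow> real) \<Rightarrow> bool" where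
  "classically_regular a K x \<longleftrightarrow>
     continuous_on {0..} x \<and>
     (a \<noteq> 0 \<longrightarrow> x differentiable_on {0..} \<and> continuous_on {0..} (ddt x)) \<and>
     (\<forall>t\<ge>0. set_integrable lborel {0..t} (\<lambda>\<tau>. K (t - \<tau>) * x \<tau>))"

definition classical_solution ::
    "(real \<Rightarrow> real) \<Rightarrow> real \<Rightarrow> real \<Rightarrow> real \<Rightarrow> (real \<Rightarrow> real) \<Rightarrow> (real \<Rightarrow> real) \<Rightarrow> bool" where
  "classical_solution K c0 c1 x0 y x \<longleftrightarrow>
     classically_regular c1 K x \<and>
     (\<forall>t\<ge>0. y t = c1 * ddt x t - c0 * x t - conv K x t) \<and>
     (c1 \<noteq> 0 \<longrightarrow> x 0 = x0)"

end

theory Submission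
  imports Defs
begin

text \<open>
  The right-hand side of the equation is an operator \<open>c1 * D - c0 - K \<star>\<close> applied to the solution, and
  the formula to be proved says that its inverse is \<open>- 1 / pi\<^sup>2\<close> times \<open>\<zeta>1 * D - \<zeta>0 - J \<star>\<close>. The Laplace
  transform of \<open>K\<close> at \<open>p\<close> is the Stieltjes transform \<open>\<integral> 1 / (p + s) d\<lambda>(s)\<close>, which up to a factor
  is the boundary value of \<open>Q_R\<close> at \<open>- p\<close>. So the relation \<open>B_R\<close>, restricted to real points to
  the left of both supports, says precisely that the symbols of the two operators have the product
  \<open>- pi\<^sup>2\<close> (\<open>stieltjes_product\<close>).

  This is transported to the time domain without distributions. Each operator is integrated twice
  and thereby becomes convolution with a continuous function (\<open>operator_kernel\<close>). The convolution
  of the two functions has the Laplace transform \<open>- pi\<^sup>2 / p ^ 4\<close>, and injectivity of the Laplace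
  transform on continuous functions (\<open>Lerch\<close>) identifies it (\<open>operator_kernels_inverse\<close>). Solutions
  may grow arbitrarily fast, so they are never transformed: what remains is algebra in the
  commutative and associative convolution product, together with the fact that integrations
  can be cancelled (\<open>convolve_inversion\<close>).

  The outcome, for any classical solution \<open>u\<close>, is that \<open>\<zeta>1 * y\<close> is the primitive of the
  continuous function \<open>\<zeta>0 * y + J \<star> y - pi\<^sup>2 * u + c1 * x0 * J\<close>. Differentiating this identity proves
  both that \<open>y\<close> is as smooth as the formula requires and that the formula returns \<open>u\<close>. The
  initial value enters only if \<open>c1\<close> is nonzero; comparing the growth of the symbols at infinity then
  shows that \<open>\<zeta>0 = \<zeta>1 = 0\<close> and that the measure \<open>\<mu>\<close> is finite, so that \<open>J\<close> is continuous up to \<open>t = 0\<close>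
  (\<open>derivative_term_excludes_inverse_derivative\<close>).
\<close>

section \<open>Convolution of causal functions\<close>

text \<open>
  The integral runs over the whole line; for functions that vanish on the negative half-line the
  integrand is supported in \<open>{0..t}\<close>. Without moving endpoints, commutativity and associativity are
  plain translation invariance and Fubini.
\<close>

definition convolve :: "(real \<Rightarrow> real) \<Rightarrow> (real \<Rightarrow> real) \<Rightarrow> real \<Rightarrow> real" (infixl "\<star>" 70)
  where "(f \<star> g) t = (\<integral>s. f (t - s) * g s \<partial>lborel)"

text \<open>
  Two classes of factors are enough: functions continuous on the closed half-line (solutions,
  sources, iterated integrals), and locally integrable ones (the kernels, which may blow up at \<open>0\<close>).
  In the algebra below every product has at least one factor of the first kind; it is then defined at
  every \<open>t\<close> and again continuous, so that identities hold pointwise.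
\<close>

definition causal_cont :: "(real \<Rightarrow> real) \<Rightarrow> bool" where
  "causal_cont f \<longleftrightarrow> (\<forall>t<0. f t = 0) \<and> continuous_on {0..} f"

definition causal_L1 :: "(real \<Rightarrow> real) \<Rightarrow> bool" where
  "causal_L1 f \<longleftrightarrow> f \<in> borel_measurable borel \<and> (\<forall>t<0. f t = 0) \<and>
     (\<forall>T. integrable lborel (\<lambda>t. indicator {..T} t * f t))"

lemma causal_cont_borel: "causal_cont f \<Longrightarrow> f \<in> borel_measurable borel"
proof -
  assume f: "causal_cont f"
  have "(\<lambda>x. indicator {0..} x *\<^sub>R f x) \<in> borel_measurable borel"
    using f by (intro borel_measurable_continuous_on_indicator) (auto simp: causal_cont_def)
  moreover have "(\<lambda>x. indicator {0..} x *\<^sub>R f x) = f"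
    using f by (auto simp: causal_cont_def indicator_def fun_eq_iff)
  ultimately show ?thesis by simp
qed

lemma causal_cont_bounded:
  assumes "causal_cont f"
  obtains M where "0 \<le> M" "\<And>t. t \<le> T \<Longrightarrow> \<bar>f t\<bar> \<le> M"
proof -
  have "compact (f ` {0..T})"
    using assms by (intro compact_continuous_image)
      (auto simp: causal_cont_def intro: continuous_on_subset)
  then obtain M where M: "\<And>x. x \<in> f ` {0..T} \<Longrightarrow> norm x \<le> M"
    by (meson bounded_iff compact_imp_bounded)
  show thesis
  proof
    show "0 \<le> max 0 M" by simp
    fix t assume "t \<le> T"
    then show "\<bar>f t\<bar> \<le> max 0 M"
      using M[of "f t"] assms by (cases "t < 0") (auto simp: causal_cont_def)
  qed
qed

lemma causal_cont_imp_L1: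
  assumes "causal_cont f"
  shows "causal_L1 f"
  unfolding causal_L1_def
proof (intro conjI allI)
  show "f \<in> borel_measurable borel" by (rule causal_cont_borel[OF assms])
  show "t < 0 \<longrightarrow> f t = 0" for t using assms by (auto simp: causal_cont_def)
  fix T
  obtain M where M: "0 \<le> M" "\<And>t. t \<le> T \<Longrightarrow> \<bar>f t\<bar> \<le> M"
    using causal_cont_bounded[OF assms, of T] by metis
  note [measurable] = causal_cont_borel[OF assms]
  show "integrable lborel (\<lambda>t. indicator {..T} t * f t)"
  proof (rule Bochner_Integration.integrable_bound)
    show "integrable lborel (\<lambda>t. indicator {0..T} t *\<^sub>R M)"
      by (rule borel_integrable_compact) auto
    show "AE t in lborel. norm (indicator {..T} t * f t) \<le> norm (indicator {0..T} t *\<^sub>R M)"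
      using M assms by (auto simp: indicator_def causal_cont_def not_le abs_mult)
  qed auto
qed

lemma convolve_integrand_integrable:
  assumes f: "causal_L1 f" and g: "causal_cont g"
  shows "integrable lborel (\<lambda>s. f (t - s) * g s)"
proof -
  obtain M where M: "0 \<le> M" "\<And>s. s \<le> t \<Longrightarrow> \<bar>g s\<bar> \<le> M"
    using causal_cont_bounded[OF g, of t] by metis
  have [measurable]: "f \<in> borel_measurable borel" using f by (auto simp: causal_L1_def)
  note [measurable] = causal_cont_borel[OF g]
  have "integrable lborel (\<lambda>s. indicator {..t} (t + (-1) * s) * f (t + (-1) * s))"
    using f by (intro lborel_integrable_real_affine) (auto simp: causal_L1_def)
  then have "integrable lborel (\<lambda>s. M * (indicator {..t} (t - s) * f (t - s)))"
    by simp
  then show ?thesis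
  proof (rule Bochner_Integration.integrable_bound)
    show "AE s in lborel. norm (f (t - s) * g s) \<le> norm (M * (indicator {..t} (t - s) * f (t - s)))"
    proof (rule AE_I2)
      fix s
      consider "s < 0" | "t < s" | "0 \<le> s" "s \<le> t" by linarith
      then show "norm (f (t - s) * g s) \<le> norm (M * (indicator {..t} (t - s) * f (t - s)))"
      proof cases
        case 3
        then show ?thesis using M(2)[of s] M(1)
          by (auto simp: abs_mult mult.commute intro!: mult_right_mono)
      qed (use f g in \<open>auto simp: causal_L1_def causal_cont_def\<close>)
    qed
  qed auto
qed

lemma convolve_commute: "f \<star> g = g \<star> f"
proof
  fix t
  have "(f \<star> g) t = (\<integral>s. f (t - (t + (-1) * s)) * g (t + (-1) * s) \<partial>lborel)"
    unfolding convolve_def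
    by (subst lborel_integral_real_affine[where c="-1" and t=t]) simp_all
  then show "(f \<star> g) t = (g \<star> f) t"
    by (simp add: convolve_def mult.commute)
qed

lemma convolve_neg:
  assumes "\<And>t. t < 0 \<Longrightarrow> f t = 0" "\<And>t. t < 0 \<Longrightarrow> g t = 0" "t < 0"
  shows "(f \<star> g) t = 0"
proof -
  have "f (t - s) * g s = 0" for s
    using assms by (cases "s < 0") auto
  then show ?thesis unfolding convolve_def by (simp only:) simp
qed

text \<open>
  Dominated convergence in \<open>\<integral> g (t - s) * f s\<close>: the continuous factor carries the parameter. It may
  jump at \<open>0\<close>, which spoils pointwise convergence of the integrand only at \<open>s = t\<close>.
\<close>

lemma causal_cont_convolve:
  assumes f: "causal_L1 f" and g: "causal_cont g"
  shows "causal_cont (f \<star> g)"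
  unfolding causal_cont_def
proof (intro conjI allI impI)
  show "(f \<star> g) t = 0" if "t < 0" for t
    using f g that by (intro convolve_neg) (auto simp: causal_L1_def causal_cont_def)
  have [measurable]: "f \<in> borel_measurable borel" using f by (auto simp: causal_L1_def)
  note [measurable] = causal_cont_borel[OF g]
  have "continuous_on {0..} (\<lambda>t. \<integral>s. g (t - s) * f s \<partial>lborel)"
    unfolding continuous_on_sequentially
  proof (intro allI ballI impI, elim conjE)
    fix X t assume t: "t \<in> {0..}" and X: "\<forall>n. X n \<in> {0::real..}" "X \<longlonglongrightarrow> t"
    from X(2) have "Bseq X" by (meson convergentI convergent_imp_Bseq)
    then obtain T where T: "\<And>n. \<bar>X n\<bar> \<le> T"
      by (metis Bseq_def real_norm_def)
    obtain M where M: "0 \<le> M" "\<And>s. s \<le> T \<Longrightarrow> \<bar>g s\<bar> \<le> M"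
      using causal_cont_bounded[OF g, of T] by metis
    have "(\<lambda>n. \<integral>s. g (X n - s) * f s \<partial>lborel) \<longlonglongrightarrow> (\<integral>s. g (t - s) * f s \<partial>lborel)"
    proof (rule integral_dominated_convergence)
      have "integrable lborel (\<lambda>s. indicator {..T} s * f s)"
        using f by (auto simp: causal_L1_def)
      then show "integrable lborel (\<lambda>s. M * \<bar>indicator {..T} s * f s\<bar>)"
        by (intro integrable_mult_right integrable_abs)
      show "AE s in lborel. norm (g (X n - s) * f s) \<le> M * \<bar>indicator {..T} s * f s\<bar>" for n
      proof (rule AE_I2)
        fix s
        consider "s < 0" | "X n < s" | "0 \<le> s" "s \<le> X n" by linarith
        then show "norm (g (X n - s) * f s) \<le> M * \<bar>indicator {..T} s * f s\<bar>"
        proof cases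
          case 3
          then show ?thesis using M(2)[of "X n - s"] M(1) T[of n]
            by (auto simp: abs_mult intro!: mult_right_mono)
        qed (use f g M(1) in \<open>auto simp: causal_L1_def causal_cont_def\<close>)
      qed
      show "AE s in lborel. (\<lambda>n. g (X n - s) * f s) \<longlonglongrightarrow> g (t - s) * f s"
      proof -
        have "(\<lambda>n. g (X n - s)) \<longlonglongrightarrow> g (t - s)" if "s \<noteq> t" for s
        proof (cases "s < t")
          case True
          have lim: "(\<lambda>n. X n - s) \<longlonglongrightarrow> t - s" using X(2) by (intro tendsto_intros)
          have "isCont g (t - s)"
            using g True by (intro continuous_on_interior[of "{0..}"]) (auto simp: causal_cont_def)
          then show ?thesis using lim by (rule isCont_tendsto_compose)
        next
          case False
          with that have "t < s" by simp
          then have "\<forall>\<^sub>F n in sequentially. X n < s" using X(2) order_tendstoD(2) by blast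
          then have "\<forall>\<^sub>F n in sequentially. g (X n - s) = g (t - s)"
            by eventually_elim (use g \<open>t < s\<close> in \<open>auto simp: causal_cont_def\<close>)
          then show ?thesis by (rule tendsto_eventually)
        qed
        moreover have "AE s in lborel. s \<noteq> t" by (rule AE_lborel_singleton)
        ultimately show ?thesis by (auto intro!: tendsto_mult_right elim!: AE_mp)
      qed
    qed auto
    then show "((\<lambda>t. \<integral>s. g (t - s) * f s \<partial>lborel) \<circ> X) \<longlonglongrightarrow> (\<integral>s. g (t - s) * f s \<partial>lborel)"
      by (simp add: o_def)
  qed
  moreover have "f \<star> g = (\<lambda>t. \<integral>s. g (t - s) * f s \<partial>lborel)"
    by (subst convolve_commute) (simp add: convolve_def fun_eq_iff)
  ultimately show "continuous_on {0..} (f \<star> g)" by simp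
qed

lemma causal_L1_abs: "causal_L1 f \<Longrightarrow> causal_L1 (\<lambda>t. \<bar>f t\<bar>)"
proof -
  assume f: "causal_L1 f"
  have "integrable lborel (\<lambda>t. \<bar>indicator {..T} t * f t\<bar>)" for T
    using f by (intro integrable_abs) (auto simp: causal_L1_def)
  then show ?thesis using f by (auto simp: causal_L1_def abs_mult)
qed

lemma causal_cont_abs: "causal_cont f \<Longrightarrow> causal_cont (\<lambda>t. \<bar>f t\<bar>)"
  by (auto simp: causal_cont_def intro: continuous_intros)

text \<open>
  Fubini applies because the convolution of the absolute values of \<open>g\<close> and \<open>h\<close> is continuous, hence
  locally bounded, as soon as one of the two is continuous.
\<close>

lemma convolve_assoc:
  assumes f: "causal_L1 f" and g: "causal_L1 g" and h: "causal_L1 h"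
    and gh: "causal_cont g \<or> causal_cont h"
  shows "f \<star> (g \<star> h) = (f \<star> g) \<star> h"
proof
  fix t
  have [measurable]: "f \<in> borel_measurable borel" "g \<in> borel_measurable borel"
    "h \<in> borel_measurable borel"
    using f g h by (auto simp: causal_L1_def)
  define F where "F = (\<lambda>s r. f (t - s) * (g (s - r) * h r))"
  have gh_int: "integrable lborel (\<lambda>r. g (s - r) * h r)" for s
    using gh
  proof
    assume "causal_cont h"
    then show ?thesis using g by (intro convolve_integrand_integrable)
  next
    assume "causal_cont g"
    then have "integrable lborel (\<lambda>r. h (s - r) * g r)"
      using h by (intro convolve_integrand_integrable)
    from lborel_integrable_real_affine[OF this, of "-1" s] show ?thesis
      by (simp add: mult.commute)
  qed
  have cont: "causal_cont ((\<lambda>t. \<bar>g t\<bar>) \<star> (\<lambda>t. \<bar>h t\<bar>))"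
    using gh
  proof
    assume "causal_cont h"
    then show ?thesis using g by (intro causal_cont_convolve causal_L1_abs causal_cont_abs)
  next
    assume "causal_cont g"
    then show ?thesis using h
      by (subst convolve_commute) (intro causal_cont_convolve causal_L1_abs causal_cont_abs)
  qed
  have "integrable (lborel \<Otimes>\<^sub>M lborel) (case_prod F)"
  proof (rule lborel_pair.Fubini_integrable)
    show "case_prod F \<in> borel_measurable (lborel \<Otimes>\<^sub>M lborel)"
      unfolding F_def by measurable
    have "integrable lborel (\<lambda>s. \<bar>f (t - s)\<bar> * ((\<lambda>t. \<bar>g t\<bar>) \<star> (\<lambda>t. \<bar>h t\<bar>)) s)"
      using convolve_integrand_integrable[OF causal_L1_abs[OF f] cont] .
    then show "integrable lborel (\<lambda>s. \<integral>r. norm (case (s, r) of (s, r) \<Rightarrow> F s r) \<partial>lborel)"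
      by (simp add: F_def abs_mult convolve_def)
    show "AE s in lborel. integrable lborel (\<lambda>r. case (s, r) of (s, r) \<Rightarrow> F s r)"
      using gh_int by (auto simp: F_def intro!: integrable_mult_right)
  qed
  then have swap: "(\<integral>r. (\<integral>s. F s r \<partial>lborel) \<partial>lborel) = (\<integral>s. (\<integral>r. F s r \<partial>lborel) \<partial>lborel)"
    by (rule lborel_pair.Fubini_integral)
  have inner: "(\<integral>s. F s r \<partial>lborel) = (f \<star> g) (t - r) * h r" for r
  proof -
    have "(\<integral>s. F s r \<partial>lborel) = (\<integral>s. f (t - s) * g (s - r) \<partial>lborel) * h r"
      by (simp add: F_def mult.assoc[symmetric])
    also have "(\<integral>s. f (t - s) * g (s - r) \<partial>lborel) = (f \<star> g) (t - r)"
      unfolding convolve_def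
      by (subst lborel_integral_real_affine[where c=1 and t=r]) (simp_all add: diff_diff_eq)
    finally show ?thesis .
  qed
  have "(f \<star> (g \<star> h)) t = (\<integral>s. (\<integral>r. F s r \<partial>lborel) \<partial>lborel)"
    by (simp add: convolve_def F_def)
  also have "\<dots> = ((f \<star> g) \<star> h) t"
    unfolding swap[symmetric] inner by (simp add: convolve_def)
  finally show "(f \<star> (g \<star> h)) t = ((f \<star> g) \<star> h) t" .
qed

lemma convolve_add:
  assumes "causal_L1 f" "causal_cont g" "causal_cont h"
  shows "f \<star> (\<lambda>t. g t + h t) = (\<lambda>t. (f \<star> g) t + (f \<star> h) t)"
  using convolve_integrand_integrable[OF assms(1,2)] convolve_integrand_integrable[OF assms(1,3)]
  by (simp add: convolve_def distrib_left fun_eq_iff)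

lemma convolve_diff:
  assumes "causal_L1 f" "causal_cont g" "causal_cont h"
  shows "f \<star> (\<lambda>t. g t - h t) = (\<lambda>t. (f \<star> g) t - (f \<star> h) t)"
  using convolve_integrand_integrable[OF assms(1,2)] convolve_integrand_integrable[OF assms(1,3)]
  by (simp add: convolve_def right_diff_distrib fun_eq_iff)

lemma convolve_scale: "f \<star> (\<lambda>t. a * g t) = (\<lambda>t. a * (f \<star> g) t)"
  unfolding convolve_def by (simp add: mult.left_commute[of _ a])

lemma causal_cont_zero: "causal_cont (\<lambda>t. 0)"
  by (simp add: causal_cont_def)

lemma causal_cont_add: "causal_cont f \<Longrightarrow> causal_cont g \<Longrightarrow> causal_cont (\<lambda>t. f t + g t)"
  by (auto simp: causal_cont_def intro!: continuous_intros)

lemma causal_cont_diff: "causal_cont f \<Longrightarrow> causal_cont g \<Longrightarrow> causal_cont (\<lambda>t. f t - g t)"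
  by (auto simp: causal_cont_def intro!: continuous_intros)

lemma causal_cont_scale: "causal_cont f \<Longrightarrow> causal_cont (\<lambda>t. a * f t)"
  by (auto simp: causal_cont_def intro!: continuous_intros)

section \<open>Integration as convolution with the unit step\<close>

definition unit_step :: "real \<Rightarrow> real" where
  "unit_step = indicator {0..}"

lemma causal_cont_unit_step: "causal_cont unit_step"
proof -
  have "continuous_on {0..} unit_step \<longleftrightarrow> continuous_on {0..} (\<lambda>t::real. 1::real)"
    by (rule continuous_on_cong) (auto simp: unit_step_def)
  then show ?thesis by (auto simp: causal_cont_def unit_step_def)
qed

lemma step_convolve_eq_integral:
  assumes "causal_cont f"
  shows "(unit_step \<star> f) t = integral {0..t} f"
proof -
  have "continuous_on {0..t} f"
    using assms by (auto simp: causal_cont_def intro: continuous_on_subset)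
  then have "set_integrable lborel {0..t} f"
    by (rule borel_integrable_atLeastAtMost')
  then have "(LBINT s:{0..t}. f s) = integral {0..t} f"
    by (rule set_borel_integral_eq_integral)
  moreover have "(unit_step \<star> f) t = (LBINT s:{0..t}. f s)"
    unfolding convolve_def set_lebesgue_integral_def
    by (rule Bochner_Integration.integral_cong)
      (use assms in \<open>auto simp: unit_step_def indicator_def causal_cont_def\<close>)
  ultimately show ?thesis by simp
qed

lemma step_convolve_has_derivative:
  assumes f: "causal_cont f" and t: "0 \<le> t"
  shows "((unit_step \<star> f) has_vector_derivative f t) (at t within {0..})"
proof -
  have "((\<lambda>u. integral {0..u} f) has_vector_derivative f t) (at t within {0..t + 1})"
    using f t by (intro integral_has_vector_derivative)
      (auto simp: causal_cont_def intro: continuous_on_subset)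
  moreover have "at t within {0..t + 1} = at t within {0..}"
    by (rule at_within_nhd[of t "{..<t+1}"]) auto
  moreover have "unit_step \<star> f = (\<lambda>u. integral {0..u} f)"
    using step_convolve_eq_integral[OF f] by auto
  ultimately show ?thesis by simp
qed

lemma at_within_half_line_nontrivial:
  fixes t :: real
  assumes "0 \<le> t"
  shows "at t within {0..} \<noteq> bot"
proof -
  have "t islimpt {t<..<t+1}" by (simp add: islimpt_greaterThanLessThan1)
  then have "t islimpt {0..}" by (rule islimpt_subset) (use assms in auto)
  then show ?thesis by (simp add: trivial_limit_within)
qed

text \<open>
  Convolution with the step is integration from \<open>0\<close>, so it is undone by differentiating. This
  cancellation law is what allows operators to be integrated before they are multiplied.
\<close>

lemma step_convolve_cancel:
  assumes f: "causal_cont f" and g: "causal_cont g" and eq: "unit_step \<star> f = unit_step \<star> g"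
  shows "f = g"
proof
  fix t
  show "f t = g t"
  proof (cases "0 \<le> t")
    case True
    have "((unit_step \<star> f) has_vector_derivative f t) (at t within {0..})"
      "((unit_step \<star> f) has_vector_derivative g t) (at t within {0..})"
      using step_convolve_has_derivative[OF f True] step_convolve_has_derivative[OF g True] eq
      by auto
    then show ?thesis
      using at_within_half_line_nontrivial[OF True] vector_derivative_unique_within by blast
  qed (use f g in \<open>auto simp: causal_cont_def\<close>)
qed

section \<open>The Laplace transform and its injectivity\<close>

definition laplace :: "(real \<Rightarrow> real) \<Rightarrow> real \<Rightarrow> real \<Rightarrow> bool" where
  "laplace f p v \<longleftrightarrow>
     f \<in> borel_measurable borel \<and> has_bochner_integral lborel (\<lambda>t. exp (- p * t) * f t) v"

lemma laplace_add: "laplace f p v \<Longrightarrow> laplace g p w \<Longrightarrow> laplace (\<lambda>t. f t + g t) p (v + w)"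
  unfolding laplace_def by (auto simp: distrib_left intro: has_bochner_integral_add)

lemma laplace_diff: "laplace f p v \<Longrightarrow> laplace g p w \<Longrightarrow> laplace (\<lambda>t. f t - g t) p (v - w)"
  unfolding laplace_def by (auto simp: right_diff_distrib intro: has_bochner_integral_diff)

lemma laplace_scale: "laplace f p v \<Longrightarrow> laplace (\<lambda>t. a * f t) p (a * v)"
  unfolding laplace_def
  by (auto simp: mult.left_commute[of _ a] intro!: has_bochner_integral_mult_right)

text \<open>
  Since \<open>exp (- p * t) = exp (- p * (t - s)) * exp (- p * s)\<close>, the exponential weight can be absorbed
  into the two factors, and the claim becomes that the integral is multiplicative on convolutions
  of integrable functions.
\<close>

lemma laplace_convolve:
  assumes f: "laplace f p v" and g: "laplace g p w"
  shows "laplace (f \<star> g) p (v * w)"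
proof -
  have [measurable]: "f \<in> borel_measurable borel" "g \<in> borel_measurable borel"
    using f g by (auto simp: laplace_def)
  define f' where "f' = (\<lambda>t. exp (- p * t) * f t)"
  define g' where "g' = (\<lambda>t. exp (- p * t) * g t)"
  have [measurable]: "f' \<in> borel_measurable borel" "g' \<in> borel_measurable borel"
    unfolding f'_def g'_def by auto
  have f': "integrable lborel f'" "integral\<^sup>L lborel f' = v"
    using f by (auto simp: laplace_def f'_def has_bochner_integral_iff)
  have g': "integrable lborel g'" "integral\<^sup>L lborel g' = w"
    using g by (auto simp: laplace_def g'_def has_bochner_integral_iff)
  define F where "F = (\<lambda>s t. f' (t - s) * g' s)"
  have shift: "(\<integral>t. h (t - s) \<partial>lborel) = (\<integral>t. h t \<partial>lborel)" for h :: "real \<Rightarrow> real" and s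
    by (subst lborel_integral_real_affine[where c=1 and t=s]) simp_all
  have shift_int: "integrable lborel (\<lambda>t. f' (t - s))" for s
    using lborel_integrable_real_affine[OF f'(1), of 1 "-s"] by simp
  have int: "integrable (lborel \<Otimes>\<^sub>M lborel) (case_prod F)"
  proof (rule lborel_pair.Fubini_integrable)
    show "case_prod F \<in> borel_measurable (lborel \<Otimes>\<^sub>M lborel)"
      unfolding F_def by measurable
    show "integrable lborel (\<lambda>s. \<integral>t. norm (case (s, t) of (s, t) \<Rightarrow> F s t) \<partial>lborel)"
      using g'(1) by (simp add: F_def abs_mult shift[where h="\<lambda>t. \<bar>f' t\<bar>"])
    show "AE s in lborel. integrable lborel (\<lambda>t. case (s, t) of (s, t) \<Rightarrow> F s t)"
      by (intro AE_I2) (use shift_int in \<open>auto simp: F_def\<close>)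
  qed
  have conv_eq: "exp (- p * t) * (f \<star> g) t = (\<integral>s. F s t \<partial>lborel)" for t
  proof -
    have "exp (- p * t) * (f (t - s) * g s) = F s t" for s
    proof -
      have "exp (- p * t) = exp (- p * (t - s)) * exp (- p * s)"
        by (simp add: exp_add[symmetric] algebra_simps)
      then show ?thesis by (simp add: F_def f'_def g'_def)
    qed
    then show ?thesis unfolding convolve_def
      by (subst integral_mult_right_zero[symmetric]) simp
  qed
  have "integrable lborel (\<lambda>t. \<integral>s. F s t \<partial>lborel)"
    using lborel_pair.integrable_snd[OF int] by simp
  moreover have "(\<integral>t. (\<integral>s. F s t \<partial>lborel) \<partial>lborel) = v * w"
    by (subst lborel_pair.Fubini_integral[OF int]) (simp add: F_def shift f' g')
  moreover have "f \<star> g \<in> borel_measurable borel"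
    unfolding convolve_def[abs_def] by measurable
  ultimately show ?thesis
    unfolding laplace_def conv_eq has_bochner_integral_iff by simp
qed

lemma nn_integral_exp_half_line:
  assumes "0 < (a::real)"
  shows "(\<integral>\<^sup>+t. ennreal (exp (- a * t)) * indicator {0..} t \<partial>lborel) = ennreal (1 / a)"
proof -
  have lim: "((\<lambda>t. - exp (- a * t) / a) \<longlongrightarrow> 0) at_top"
  proof -
    have "((\<lambda>t. exp (- a * t)) \<longlongrightarrow> 0) at_top"
      by (rule filterlim_compose[OF exp_at_bot
            filterlim_tendsto_neg_mult_at_bot[OF tendsto_const _ filterlim_ident]])
        (use assms in simp)
    from tendsto_divide[OF tendsto_minus[OF this] tendsto_const[of a]] show ?thesis
      using assms by simp
  qed
  have "(\<integral>\<^sup>+t. ennreal (exp (- a * t)) * indicator {0..} t \<partial>lborel)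
      = ennreal (0 - (- exp (- a * 0) / a))"
    using assms
    by (intro nn_integral_FTC_atLeast[OF _ _ _ lim])
      (auto intro!: derivative_eq_intros)
  then show ?thesis by simp
qed

lemma laplace_unit_step:
  assumes "0 < p"
  shows "laplace unit_step p (1 / p)"
proof -
  have [measurable]: "unit_step \<in> borel_measurable borel"
    by (rule causal_cont_borel[OF causal_cont_unit_step])
  have "has_bochner_integral lborel (\<lambda>t. exp (- p * t) * unit_step t) (1 / p)"
  proof (rule has_bochner_integral_nn_integral)
    show "AE t in lborel. 0 \<le> exp (- p * t) * unit_step t"
      by (auto simp: unit_step_def)
    have "(\<integral>\<^sup>+t. ennreal (exp (- p * t) * unit_step t) \<partial>lborel)
        = (\<integral>\<^sup>+t. ennreal (exp (- p * t)) * indicator {0..} t \<partial>lborel)"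
      by (intro nn_integral_cong) (auto simp: unit_step_def indicator_def)
    then show "(\<integral>\<^sup>+t. ennreal (exp (- p * t) * unit_step t) \<partial>lborel) = ennreal (1 / p)"
      using nn_integral_exp_half_line[OF assms] by simp
  qed (use assms in auto)
  then show ?thesis by (simp add: laplace_def)
qed

text \<open>
  Under \<open>s = exp (- t)\<close> the hypothesis on moments says that the function \<open>g\<close> with
  \<open>g (exp (- t)) = h t\<close> is orthogonal to all polynomials with respect to the image measure. The decay
  of \<open>h\<close> makes \<open>g\<close> continuous on \<open>{0..1}\<close>, so polynomials approximate it uniformly and it is orthogonal
  to itself. The substitution is never carried out in the integral.
\<close>

lemma Weierstrass_moments_exp:
  assumes h: "integrable lborel h" "continuous_on {0..} h" "\<And>t. t < 0 \<Longrightarrow> h t = 0"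
    and decay: "\<And>t. 0 \<le> t \<Longrightarrow> \<bar>h t\<bar> \<le> C * exp (- t)"
    and moments: "\<And>n. (\<integral>t. exp (- t) ^ n * h t \<partial>lborel) = (0::real)"
  shows "AE t in lborel. h t = 0"
proof -
  have [measurable]: "h \<in> borel_measurable borel" using h(1) by auto
  define g where "g = (\<lambda>s. if s \<le> 0 then 0 else h (- ln s))"
  have g_exp: "h t = g (exp (- t))" for t by (simp add: g_def)
  have "C \<ge> 0" using decay[of 0] by simp
  have g_bound: "\<bar>g s\<bar> \<le> C * \<bar>s\<bar>" if "s \<le> 1" for s
    using decay[of "- ln s"] that \<open>C \<ge> 0\<close> by (auto simp: g_def intro: mult_nonneg_nonpos)
  have cont: "continuous_on {0..1} g"
  proof (rule continuous_on_eq_continuous_within[THEN iffD2], rule ballI)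
    fix s :: real assume s: "s \<in> {0..1}"
    show "continuous (at s within {0..1}) g"
    proof (cases "s = 0")
      case True
      have "(g \<longlongrightarrow> 0) (at 0 within {0..1})"
      proof (rule Lim_null_comparison)
        show "\<forall>\<^sub>F s in at 0 within {0..1}. norm (g s) \<le> C * \<bar>s\<bar>"
          unfolding eventually_at_filter
          by (intro always_eventually allI impI) (metis g_bound atLeastAtMost_iff real_norm_def)
        have "((\<lambda>s. C * \<bar>s\<bar>) \<longlongrightarrow> C * \<bar>0\<bar>) (at 0 within {0..1::real})"
          by (intro tendsto_intros)
        then show "((\<lambda>s. C * \<bar>s\<bar>) \<longlongrightarrow> 0) (at 0 within {0..1::real})" by simp
      qed
      then show ?thesis using True by (simp add: continuous_within g_def)
    next
      case False
      have "continuous_on {0<..1} (\<lambda>s. h (- ln s))"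
        by (rule continuous_on_compose2[OF h(2)]) (auto intro!: continuous_intros)
      then have "continuous_on {0<..1} g"
        by (rule continuous_on_eq) (auto simp: g_def)
      then have "continuous (at s within {0<..1}) g"
        using s False by (auto simp: continuous_on_eq_continuous_within)
      moreover have "at s within {0<..1} = at s within {0..1}"
        by (rule at_within_nhd[of s "{0<..}"]) (use s False in auto)
      ultimately show ?thesis by simp
    qed
  qed
  have h_bd: "\<bar>h t\<bar> \<le> C" for t
  proof (cases "0 \<le> t")
    case True
    then have "C * exp (- t) \<le> C * 1" using \<open>C \<ge> 0\<close> by (intro mult_left_mono) auto
    then show ?thesis using decay[OF True] by simp
  qed (use h(3)[of t] \<open>C \<ge> 0\<close> in auto)
  have int_bdd_mult: "integrable lborel (\<lambda>t. q t * h t)"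
    if [measurable]: "q \<in> borel_measurable borel" and q: "\<And>t. 0 \<le> t \<Longrightarrow> \<bar>q t\<bar> \<le> B" for q B
  proof (rule Bochner_Integration.integrable_bound)
    show "integrable lborel (\<lambda>t. B * h t)" using h(1) by simp
    show "AE t in lborel. norm (q t * h t) \<le> norm (B * h t)"
    proof (rule AE_I2)
      show "norm (q t * h t) \<le> norm (B * h t)" for t
        using q[of t] h(3)[of t]
        by (cases "0 \<le> t") (auto simp: abs_mult intro!: mult_right_mono)
    qed
  qed auto
  have sq_int: "integrable lborel (\<lambda>t. h t * h t)"
    using h_bd by (intro int_bdd_mult) auto
  have small: "\<bar>\<integral>t. h t * h t \<partial>lborel\<bar> \<le> e * (\<integral>t. \<bar>h t\<bar> \<partial>lborel)" if "0 < e" for e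
  proof -
    obtain q where q: "real_polynomial_function q" "\<And>s. s \<in> {0..1} \<Longrightarrow> \<bar>g s - q s\<bar> < e"
      using Stone_Weierstrass_real_polynomial_function[OF compact_Icc cont \<open>0 < e\<close>] by metis
    obtain a n where q_eq: "q = (\<lambda>s. \<Sum>i\<le>n. a i * s ^ i)"
      using q(1) by (auto simp: real_polynomial_function_iff_sum)
    have pow_int: "integrable lborel (\<lambda>t. exp (- t) ^ i * h t)" for i
      by (rule int_bdd_mult[of _ 1]) (auto simp: power_le_one)
    have q_int: "integrable lborel (\<lambda>t. q (exp (- t)) * h t)"
      unfolding q_eq sum_distrib_right mult.assoc using pow_int by auto
    have "(\<integral>t. q (exp (- t)) * h t \<partial>lborel) = 0"
      unfolding q_eq sum_distrib_right mult.assoc using pow_int moments by simp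
    then have "(\<integral>t. h t * h t \<partial>lborel) = (\<integral>t. h t * h t - q (exp (- t)) * h t \<partial>lborel)"
      using sq_int q_int by simp
    also have "\<bar>\<dots>\<bar> \<le> (\<integral>t. \<bar>h t * h t - q (exp (- t)) * h t\<bar> \<partial>lborel)"
      by (rule integral_abs_bound)
    also have "\<dots> \<le> (\<integral>t. e * \<bar>h t\<bar> \<partial>lborel)"
    proof (rule integral_mono)
      show "\<bar>h t * h t - q (exp (- t)) * h t\<bar> \<le> e * \<bar>h t\<bar>" for t
      proof (cases "0 \<le> t")
        case True
        then have "\<bar>h t - q (exp (- t))\<bar> \<le> e"
          using q(2)[of "exp (- t)"] g_exp[of t] by auto
        then have "\<bar>h t - q (exp (- t))\<bar> * \<bar>h t\<bar> \<le> e * \<bar>h t\<bar>"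
          by (intro mult_right_mono) auto
        then show ?thesis by (simp add: abs_mult[symmetric] algebra_simps)
      qed (simp add: h(3))
    qed (use sq_int q_int h(1) in auto)
    finally show ?thesis by simp
  qed
  have "(\<integral>t. h t * h t \<partial>lborel) = 0"
  proof (rule ccontr)
    define A where "A = (\<integral>t. \<bar>h t\<bar> \<partial>lborel)"
    assume "(\<integral>t. h t * h t \<partial>lborel) \<noteq> 0"
    then have pos: "0 < \<bar>\<integral>t. h t * h t \<partial>lborel\<bar>" (is "0 < ?S") unfolding zero_less_abs_iff .
    have A: "0 \<le> A" by (simp add: A_def)
    have ratio: "A / (2 * (A + 1)) < 1" using A by simp
    have "0 < ?S / (2 * (A + 1))" using pos A by (intro divide_pos_pos) auto
    from small[OF this] have "?S \<le> ?S * (A / (2 * (A + 1)))"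
      unfolding A_def by (simp add: mult.commute)
    also have "\<dots> < ?S * 1" using pos ratio by (intro mult_strict_left_mono)
    finally show False by simp
  qed
  then have "AE t in lborel. h t * h t = 0"
    using integral_nonneg_eq_0_iff_AE[OF sq_int] by simp
  then show ?thesis by simp
qed

text \<open>
  The moment lemma needs pointwise decay, while convergence of the Laplace integral only gives
  decay on average. One integration cures this: the primitive \<open>F\<close> of \<open>f\<close> satisfies
  \<open>\<bar>F t\<bar> \<le> C * exp (c * t)\<close>, its transform vanishes as well, and \<open>f\<close> is recovered by cancelling the step.
\<close>

lemma Lerch:
  assumes f: "causal_cont f" and lap: "\<And>p. b \<le> p \<Longrightarrow> laplace f p 0"
  shows "f = (\<lambda>t. 0)"
proof -
  define c where "c = max b 1"
  define F where "F = unit_step \<star> f"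
  have F: "causal_cont F"
    unfolding F_def by (rule causal_cont_convolve[OF causal_cont_imp_L1[OF causal_cont_unit_step] f])
  have lapF: "laplace F p 0" if "c \<le> p" for p
    using laplace_convolve[OF laplace_unit_step lap, of p] that
    unfolding F_def c_def by (auto simp: max_def split: if_splits)
  define C where "C = (\<integral>s. \<bar>exp (- c * s) * f s\<bar> \<partial>lborel)"
  have "integrable lborel (\<lambda>s. exp (- c * s) * f s)"
    using lap[of c] by (auto simp: laplace_def has_bochner_integral_iff c_def)
  then have C_int: "integrable lborel (\<lambda>s. exp (c * t) * \<bar>exp (- c * s) * f s\<bar>)" for t
    by (intro integrable_mult_right integrable_abs)
  have F_bound: "\<bar>F t\<bar> \<le> exp (c * t) * C" for t
  proof -
    have "\<bar>F t\<bar> \<le> (\<integral>s. \<bar>unit_step (t - s) * f s\<bar> \<partial>lborel)"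
      unfolding F_def convolve_def by (rule integral_abs_bound)
    also have "\<dots> \<le> (\<integral>s. exp (c * t) * \<bar>exp (- c * s) * f s\<bar> \<partial>lborel)"
    proof (rule integral_mono[OF _ C_int])
      show "integrable lborel (\<lambda>s. \<bar>unit_step (t - s) * f s\<bar>)"
        using convolve_integrand_integrable[OF causal_cont_imp_L1[OF causal_cont_unit_step] f]
        by (intro integrable_abs)
      show "\<bar>unit_step (t - s) * f s\<bar> \<le> exp (c * t) * \<bar>exp (- c * s) * f s\<bar>" for s
      proof (cases "s \<le> t")
        case True
        have "0 < c" by (simp add: c_def)
        have "1 * \<bar>f s\<bar> \<le> exp (c * t - c * s) * \<bar>f s\<bar>"
          using True \<open>0 < c\<close> by (intro mult_right_mono) auto
        then show ?thesis using True
          by (simp add: unit_step_def abs_mult exp_diff exp_minus field_simps)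
      qed (simp add: unit_step_def)
    qed
    finally show ?thesis by (simp add: C_def)
  qed
  \<comment> \<open>The extra \<open>1\<close> in the exponent turns the bound on \<open>F\<close> into the decay \<open>C * exp (- t)\<close>.\<close>
  define h where "h = (\<lambda>t. exp (- (c + 1) * t) * F t)"
  have "AE t in lborel. h t = 0"
  proof (rule Weierstrass_moments_exp)
    show "integrable lborel h"
      using lapF[of "c + 1"] by (simp add: laplace_def h_def has_bochner_integral_iff)
    show "continuous_on {0..} h"
      using F unfolding h_def causal_cont_def by (intro continuous_intros) auto
    show "h t = 0" if "t < 0" for t using F that by (auto simp: h_def causal_cont_def)
    show "\<bar>h t\<bar> \<le> C * exp (- t)" if "0 \<le> t" for t
    proof -
      have "\<bar>h t\<bar> \<le> exp (- (c + 1) * t) * (exp (c * t) * C)"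
        using F_bound[of t] by (simp add: h_def abs_mult)
      also have "\<dots> = C * (exp (- (c + 1) * t) * exp (c * t))" by simp
      also have "\<dots> = C * exp (- t)" unfolding exp_add[symmetric] by (simp add: algebra_simps)
      finally show ?thesis .
    qed
    show "(\<integral>t. exp (- t) ^ n * h t \<partial>lborel) = 0" for n
    proof -
      have "exp (- t) ^ n * h t = exp (- (c + 1 + real n) * t) * F t" for t
        unfolding h_def exp_of_nat_mult[symmetric] mult.assoc[symmetric] exp_add[symmetric]
        by (simp add: algebra_simps)
      moreover have "laplace F (c + 1 + real n) 0" by (rule lapF) simp
      ultimately show ?thesis by (simp add: laplace_def has_bochner_integral_iff)
    qed
  qed
  then have AE0: "AE t in lborel. F t = 0" by (simp add: h_def)
  have "unit_step \<star> F = unit_step \<star> (\<lambda>t. 0)"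
  proof
    fix t
    have [measurable]: "F \<in> borel_measurable borel" "unit_step \<in> borel_measurable borel"
      using F causal_cont_unit_step by (auto intro: causal_cont_borel)
    show "(unit_step \<star> F) t = (unit_step \<star> (\<lambda>t. 0)) t"
      unfolding convolve_def by (rule integral_cong_AE) (use AE0 in auto)
  qed
  then have "F = (\<lambda>t. 0)" by (rule step_convolve_cancel[OF F causal_cont_zero])
  then have "unit_step \<star> f = unit_step \<star> (\<lambda>t. 0)"
    by (simp add: F_def convolve_def fun_eq_iff)
  then show ?thesis by (rule step_convolve_cancel[OF f causal_cont_zero])
qed

section \<open>Bilateral Laplace and Stieltjes transforms of measures\<close>

lemma one_over_Suc_tendsto_0: "(\<lambda>n. 1 / real (Suc n)) \<longlonglongrightarrow> 0"
  using LIMSEQ_inverse_real_of_nat by (simp add: inverse_eq_divide del: of_nat_Suc)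

lemma reciprocal_shift_tendsto_0: "(\<lambda>n. 1 / (p + real n + s)) \<longlonglongrightarrow> (0::real)"
proof -
  have "filterlim (\<lambda>n. (p + s) + real n) at_top sequentially"
    by (rule filterlim_tendsto_add_at_top[OF tendsto_const filterlim_real_sequentially])
  then have "(\<lambda>n. 1 / ((p + s) + real n)) \<longlonglongrightarrow> 0"
    by (intro tendsto_divide_0[OF tendsto_const] filterlim_at_top_imp_at_infinity)
  then show ?thesis by (simp add: algebra_simps)
qed

lemma ratio_shift_tendsto_1: "(\<lambda>n. (p + real n) * (1 / (p + real n + s))) \<longlonglongrightarrow> (1::real)"
proof -
  have "(\<lambda>n. 1 - s * (1 / (p + real n + s))) \<longlonglongrightarrow> 1 - s * 0"
    by (intro tendsto_intros reciprocal_shift_tendsto_0)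
  moreover have "\<forall>\<^sub>F n in sequentially.
      1 - s * (1 / (p + real n + s)) = (p + real n) * (1 / (p + real n + s))"
  proof -
    have "\<forall>\<^sub>F n in sequentially. - (p + s) < real n"
      using filterlim_real_sequentially by (auto simp: filterlim_at_top_dense)
    then show ?thesis by eventually_elim (simp add: field_simps)
  qed
  ultimately show ?thesis by (auto intro: Lim_transform_eventually)
qed

text \<open>
  The complement of the support is a union of open null sets; by the Lindelof property countably
  many of them suffice, so it is null itself.
\<close>

lemma null_below_support:
  assumes sets: "sets \<nu> = sets borel" and below: "\<And>s. s \<in> measure_support \<nu> \<Longrightarrow> a \<le> s"
  shows "AE s in \<nu>. a \<le> s"
proof -
  define \<F> where "\<F> = {U. open U \<and> emeasure \<nu> U = 0}"
  obtain \<G> where G: "\<G> \<subseteq> \<F>" "countable \<G>" "\<Union>\<G> = \<Union>\<F>"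
    using Lindelof[of \<F>] by (auto simp: \<F>_def)
  have "\<Union>\<G> \<in> null_sets \<nu>"
    using G by (intro null_sets_UN'[of \<G> "\<lambda>U. U", simplified])
      (auto simp: \<F>_def null_sets_def sets)
  then have "AE s in \<nu>. s \<notin> \<Union>\<G>" by (rule AE_not_in)
  moreover have "s \<notin> \<Union>\<G> \<Longrightarrow> a \<le> s" for s
    using below[of s] unfolding G(3) by (auto simp: \<F>_def measure_support_def)
  ultimately show ?thesis by (auto elim: AE_mp)
qed

definition causal_part :: "(real \<Rightarrow> real) \<Rightarrow> real \<Rightarrow> real" where
  "causal_part f t = (if 0 \<le> t then f t else 0)"

text \<open>
  This is the Laplace transform at \<open>p\<close> of \<open>Lb \<nu>\<close> restricted to the half-line, and, up to the factor
  \<open>- \<i> / pi\<close>, the boundary value of \<open>Q_R \<nu>\<close> at the real point \<open>- p\<close> to the left of the support.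
\<close>

definition stieltjes :: "real measure \<Rightarrow> real \<Rightarrow> real" where
  "stieltjes \<nu> p = (\<integral>s. 1 / (p + s) \<partial>\<nu>)"

lemma laplace_imp_causal_L1:
  assumes f: "\<And>t. t < 0 \<Longrightarrow> f t = 0" and lap: "laplace f p v" and p: "0 \<le> p"
  shows "causal_L1 f"
  unfolding causal_L1_def
proof (intro conjI allI impI)
  show [measurable]: "f \<in> borel_measurable borel" using lap by (simp add: laplace_def)
  fix T
  have "integrable lborel (\<lambda>t. exp (p * T) * (exp (- p * t) * f t))"
    using lap by (intro integrable_mult_right) (auto simp: laplace_def has_bochner_integral_iff)
  then show "integrable lborel (\<lambda>t. indicator {..T} t * f t)"
  proof (rule Bochner_Integration.integrable_bound)
    show "AE t in lborel. norm (indicator {..T} t * f t) \<le> norm (exp (p * T) * (exp (- p * t) * f t))"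
    proof (rule AE_I2)
      fix t
      show "norm (indicator {..T} t * f t) \<le> norm (exp (p * T) * (exp (- p * t) * f t))"
      proof (cases "t \<le> T")
        case True
        have "1 * \<bar>f t\<bar> \<le> exp (p * T - p * t) * \<bar>f t\<bar>"
          using True p by (intro mult_right_mono) (auto intro: mult_left_mono)
        then show ?thesis using True by (simp add: abs_mult exp_diff exp_minus field_simps)
      qed simp
    qed
  qed auto
qed (rule f)

text \<open>
  All that is used of a measure in \<open>M_exp 1\<close>: it lives on \<open>{1 - p\<^sub>0..}\<close>, and its Stieltjes transform
  converges at \<open>p\<^sub>0\<close>. The margin \<open>1\<close> keeps the denominators \<open>p + s\<close> with \<open>p\<^sub>0 \<le> p\<close> away from \<open>0\<close>.
\<close>

locale half_line_measure = sigma_finite_measure \<nu> for \<nu> :: "real measure" +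
  fixes p\<^sub>0 :: real
  assumes sets_eq [measurable_cong]: "sets \<nu> = sets borel"
    and p\<^sub>0_pos: "0 < p\<^sub>0"
    and AE_ge: "AE s in \<nu>. 1 \<le> p\<^sub>0 + s"
    and stieltjes_integrable_p\<^sub>0: "integrable \<nu> (\<lambda>s. 1 / (p\<^sub>0 + s))"
begin

lemma AE_stieltjes_bound:
  assumes "p\<^sub>0 \<le> p"
  shows "AE s in \<nu>. 0 < p\<^sub>0 + s \<and> 0 < p + s \<and> 1 / (p + s) \<le> 1 / (p\<^sub>0 + s)"
  using AE_ge by eventually_elim (use assms in \<open>auto intro!: frac_le\<close>)

lemma stieltjes_integrable:
  assumes "p\<^sub>0 \<le> p"
  shows "integrable \<nu> (\<lambda>s. 1 / (p + s))"
proof (rule Bochner_Integration.integrable_bound[OF stieltjes_integrable_p\<^sub>0])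
  show "AE s in \<nu>. norm (1 / (p + s)) \<le> norm (1 / (p\<^sub>0 + s))"
    using AE_stieltjes_bound[OF assms] by eventually_elim auto
qed measurable

lemma exp_integrable:
  assumes t: "0 < t"
  shows "integrable \<nu> (\<lambda>s. exp (- s * t))"
proof (rule Bochner_Integration.integrable_bound)
  show "integrable \<nu> (\<lambda>s. exp (p\<^sub>0 * t) / t * (1 / (p\<^sub>0 + s)))"
    using stieltjes_integrable_p\<^sub>0 by (rule integrable_mult_right)
  show "AE s in \<nu>. norm (exp (- s * t)) \<le> norm (exp (p\<^sub>0 * t) / t * (1 / (p\<^sub>0 + s)))"
    using AE_ge
  proof eventually_elim
    case (elim s)
    have "t * (p\<^sub>0 + s) \<le> exp (t * (p\<^sub>0 + s))"
      using exp_ge_add_one_self[of "t * (p\<^sub>0 + s)"] by linarith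
    then have "exp (- s * t) * (t * (p\<^sub>0 + s)) \<le> exp (- s * t) * exp (t * (p\<^sub>0 + s))"
      by (intro mult_left_mono) auto
    also have "\<dots> = exp (p\<^sub>0 * t)" unfolding exp_add[symmetric] by (simp add: algebra_simps)
    finally have "exp (- s * t) \<le> exp (p\<^sub>0 * t) / (t * (p\<^sub>0 + s))"
      using elim t by (subst pos_le_divide_eq) auto
    then show ?case using elim t by simp
  qed
qed measurable

lemma Lb_borel [measurable]: "Lb \<nu> \<in> borel_measurable borel"
  unfolding Lb_def[abs_def] by measurable

text \<open>
  Tonelli, with \<open>exp (- p * t) * exp (- s * t)\<close> integrated over the half-line first.
\<close>

lemma laplace_Lb:
  assumes p: "p\<^sub>0 \<le> p"
  shows "laplace (causal_part (Lb \<nu>)) p (stieltjes \<nu> p)"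
proof -
  interpret pair_sigma_finite lborel \<nu> ..
  have [measurable]: "causal_part (Lb \<nu>) \<in> borel_measurable borel"
    unfolding causal_part_def[abs_def] by measurable
  have "has_bochner_integral lborel (\<lambda>t. exp (- p * t) * causal_part (Lb \<nu>) t) (stieltjes \<nu> p)"
  proof (rule has_bochner_integral_nn_integral)
    have "(\<integral>\<^sup>+t. ennreal (exp (- p * t) * causal_part (Lb \<nu>) t) \<partial>lborel)
        = (\<integral>\<^sup>+t. (\<integral>\<^sup>+s. ennreal (exp (- (p + s) * t)) * indicator {0..} t \<partial>\<nu>) \<partial>lborel)"
    proof (rule nn_integral_cong_AE)
      \<comment> \<open>At \<open>t = 0\<close> the integral defining \<open>Lb\<close> may diverge.\<close>
      have "AE t in lborel. t \<noteq> (0::real)" by (rule AE_lborel_singleton)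
      then show "AE t in lborel. ennreal (exp (- p * t) * causal_part (Lb \<nu>) t)
          = (\<integral>\<^sup>+s. ennreal (exp (- (p + s) * t)) * indicator {0..} t \<partial>\<nu>)"
      proof eventually_elim
        case (elim t)
        show ?case
        proof (cases "0 < t")
          case True
          have "(\<integral>\<^sup>+s. ennreal (exp (- (p + s) * t)) * indicator {0..} t \<partial>\<nu>)
              = (\<integral>\<^sup>+s. ennreal (exp (- p * t) * exp (- s * t)) \<partial>\<nu>)"
            using True by (intro nn_integral_cong)
              (simp add: exp_add[symmetric] algebra_simps)
          also have "\<dots> = ennreal (\<integral>s. exp (- p * t) * exp (- s * t) \<partial>\<nu>)"
            using exp_integrable[OF True] by (intro nn_integral_eq_integral integrable_mult_right) auto
          also have "\<dots> = ennreal (exp (- p * t) * causal_part (Lb \<nu>) t)"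
            using True by (simp add: causal_part_def Lb_def)
          finally show ?thesis by simp
        next
          case False
          then show ?thesis using elim by (simp add: causal_part_def)
        qed
      qed
    qed
    also have "\<dots> = (\<integral>\<^sup>+s. (\<integral>\<^sup>+t. ennreal (exp (- (p + s) * t)) * indicator {0..} t \<partial>lborel) \<partial>\<nu>)"
      by (rule Fubini'[symmetric]) measurable
    also have "\<dots> = (\<integral>\<^sup>+s. ennreal (1 / (p + s)) \<partial>\<nu>)"
    proof (rule nn_integral_cong_AE)
      show "AE s in \<nu>. (\<integral>\<^sup>+t. ennreal (exp (- (p + s) * t)) * indicator {0..} t \<partial>lborel)
          = ennreal (1 / (p + s))"
        using AE_stieltjes_bound[OF p]
        by eventually_elim (use nn_integral_exp_half_line in blast)
    qed
    also have "\<dots> = ennreal (stieltjes \<nu> p)"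
      unfolding stieltjes_def
    proof (rule nn_integral_eq_integral[OF stieltjes_integrable[OF p]])
      show "AE s in \<nu>. 0 \<le> 1 / (p + s)"
        using AE_stieltjes_bound[OF p] by eventually_elim auto
    qed
    finally show "(\<integral>\<^sup>+t. ennreal (exp (- p * t) * causal_part (Lb \<nu>) t) \<partial>lborel)
        = ennreal (stieltjes \<nu> p)" .
    show "AE t in lborel. 0 \<le> exp (- p * t) * causal_part (Lb \<nu>) t"
      by (auto simp: causal_part_def Lb_def intro!: integral_nonneg_AE)
    show "0 \<le> stieltjes \<nu> p"
      unfolding stieltjes_def
      using AE_stieltjes_bound[OF p] by (intro integral_nonneg_AE) (auto elim: AE_mp)
  qed measurable
  then show ?thesis by (simp add: laplace_def)
qed

lemma causal_L1_Lb: "causal_L1 (causal_part (Lb \<nu>))"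
  by (rule laplace_imp_causal_L1[OF _ laplace_Lb[OF order_refl]])
    (use p\<^sub>0_pos in \<open>auto simp: causal_part_def\<close>)

lemma stieltjes_tendsto_0: "(\<lambda>n. stieltjes \<nu> (p\<^sub>0 + real n)) \<longlonglongrightarrow> 0"
proof -
  have shift: "AE s in \<nu>. 0 < p\<^sub>0 + s \<and> 0 < p\<^sub>0 + real n + s \<and>
      1 / (p\<^sub>0 + real n + s) \<le> 1 / (p\<^sub>0 + s)" for n
    by (rule AE_stieltjes_bound) simp
  have "(\<lambda>n. stieltjes \<nu> (p\<^sub>0 + real n)) \<longlonglongrightarrow> (\<integral>s. 0 \<partial>\<nu>)"
    unfolding stieltjes_def
  proof (rule integral_dominated_convergence[where w="\<lambda>s. 1 / (p\<^sub>0 + s)"])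
    show "AE s in \<nu>. (\<lambda>n. 1 / (p\<^sub>0 + real n + s)) \<longlonglongrightarrow> 0"
      by (intro AE_I2 reciprocal_shift_tendsto_0)
    show "AE s in \<nu>. norm (1 / (p\<^sub>0 + real n + s)) \<le> 1 / (p\<^sub>0 + s)" for n
      using shift[of n] by eventually_elim auto
  qed (use stieltjes_integrable_p\<^sub>0 in auto)
  then show ?thesis by simp
qed

text \<open>
  Approaching \<open>- p\<close> vertically from the upper half-plane only increases the distance to the support,
  so \<open>1 / (p\<^sub>0 + s)\<close> dominates.
\<close>

lemma Q_R_boundary_value:
  assumes p: "p\<^sub>0 \<le> p"
  shows "(\<lambda>n. Q_R \<nu> (Complex (- p) (1 / real (Suc n))))
    \<longlonglongrightarrow> - (\<i> / of_real pi) * of_real (stieltjes \<nu> p)"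
proof -
  have "(\<lambda>n. Q_R \<nu> (Complex (- p) (1 / real (Suc n))))
      \<longlonglongrightarrow> (\<integral>s. - (\<i> / of_real pi) * of_real (1 / (p + s)) \<partial>\<nu>)"
    unfolding Q_R_def
  proof (rule integral_dominated_convergence[where w="\<lambda>s. 1 / (p\<^sub>0 + s)"])
    show "AE s in \<nu>. (\<lambda>n. \<i> / (of_real pi * (Complex (- p) (1 / real (Suc n)) - of_real s)))
        \<longlonglongrightarrow> - (\<i> / of_real pi) * of_real (1 / (p + s))"
      using AE_stieltjes_bound[OF p]
    proof eventually_elim
      case (elim s)
      have "(\<lambda>n. Complex (- p) (1 / real (Suc n))) \<longlonglongrightarrow> Complex (- p) 0"
        
        by (intro tendsto_Complex tendsto_const one_over_Suc_tendsto_0)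
      then have "(\<lambda>n. \<i> / (of_real pi * (Complex (- p) (1 / real (Suc n)) - of_real s)))
          \<longlonglongrightarrow> \<i> / (of_real pi * (Complex (- p) 0 - of_real s))"
        using elim
        by (intro tendsto_divide tendsto_mult tendsto_diff tendsto_const) (auto simp: complex_eq_iff)
      also have "\<i> / (of_real pi * (Complex (- p) 0 - of_real s))
          = - (\<i> / of_real pi) * of_real (1 / (p + s))"
      proof -
        have "Complex (- p) 0 - of_real s = - of_real (p + s)" by (simp add: complex_eq_iff)
        then show ?thesis by (simp only:) (simp del: of_real_add)
      qed
      finally show ?case .
    qed
    show "AE s in \<nu>. norm (\<i> / (of_real pi * (Complex (- p) (1 / real (Suc n)) - of_real s)))
        \<le> 1 / (p\<^sub>0 + s)" for n
      using AE_stieltjes_bound[OF p]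
    proof eventually_elim
      case (elim s)
      let ?w = "Complex (- p) (1 / real (Suc n)) - of_real s"
      have "p + s \<le> norm ?w" using abs_Re_le_cmod[of ?w] by simp
      moreover have "1 * norm ?w \<le> pi * norm ?w"
        using pi_gt3 by (intro mult_right_mono) auto
      ultimately have "p + s \<le> pi * norm ?w" by simp
      then have "1 / (pi * norm ?w) \<le> 1 / (p + s)"
        using elim by (intro divide_left_mono) auto
      also have "\<dots> \<le> 1 / (p\<^sub>0 + s)" using elim by simp
      finally show ?case by (simp add: norm_divide norm_mult)
    qed
  qed (use stieltjes_integrable_p\<^sub>0 in auto)
  also have "(\<integral>s. - (\<i> / of_real pi) * of_real (1 / (p + s)) \<partial>\<nu>)
      = - (\<i> / of_real pi) * of_real (stieltjes \<nu> p)"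
    unfolding stieltjes_def integral_mult_right_zero integral_complex_of_real ..
  finally show ?thesis .
qed

text \<open>
  \<open>q / (q + s)\<close> tends to \<open>1\<close> as \<open>q\<close> grows, so by Fatou a bound on \<open>q * stieltjes \<nu> q\<close> bounds the total mass.
  For a finite measure supported on a half-line, \<open>Lb\<close> is continuous up to and including \<open>t = 0\<close>.
\<close>

lemma causal_cont_Lb:
  assumes bound: "\<And>n. (p\<^sub>0 + real n) * stieltjes \<nu> (p\<^sub>0 + real n) \<le> B"
  shows "causal_cont (causal_part (Lb \<nu>))"
proof -
  have "(\<integral>\<^sup>+s. ennreal 1 \<partial>\<nu>) = (\<integral>\<^sup>+s. liminf (\<lambda>n. ennreal ((p\<^sub>0 + real n) * (1 / (p\<^sub>0 + real n + s)))) \<partial>\<nu>)"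
  proof (rule nn_integral_cong)
    fix s
    have "(\<lambda>n. (p\<^sub>0 + real n) * (1 / (p\<^sub>0 + real n + s))) \<longlonglongrightarrow> 1"
      by (rule ratio_shift_tendsto_1)
    then have "(\<lambda>n. ennreal ((p\<^sub>0 + real n) * (1 / (p\<^sub>0 + real n + s)))) \<longlonglongrightarrow> ennreal 1"
      by (rule tendsto_ennrealI)
    then show "ennreal 1 = liminf (\<lambda>n. ennreal ((p\<^sub>0 + real n) * (1 / (p\<^sub>0 + real n + s))))"
      by (simp add: lim_imp_Liminf)
  qed
  also have "\<dots> \<le> liminf (\<lambda>n. \<integral>\<^sup>+s. ennreal ((p\<^sub>0 + real n) * (1 / (p\<^sub>0 + real n + s))) \<partial>\<nu>)"
    by (rule nn_integral_liminf) measurable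
  also have "\<dots> \<le> liminf (\<lambda>n::nat. ennreal B)"
  proof (rule Liminf_mono, rule always_eventually, rule allI)
    fix n
    have shift: "AE s in \<nu>. 0 < p\<^sub>0 + s \<and> 0 < p\<^sub>0 + real n + s \<and>
        1 / (p\<^sub>0 + real n + s) \<le> 1 / (p\<^sub>0 + s)"
      by (rule AE_stieltjes_bound) simp
    have "(\<integral>\<^sup>+s. ennreal ((p\<^sub>0 + real n) * (1 / (p\<^sub>0 + real n + s))) \<partial>\<nu>)
        = ennreal ((p\<^sub>0 + real n) * stieltjes \<nu> (p\<^sub>0 + real n))"
      unfolding stieltjes_def integral_mult_right_zero[symmetric]
    proof (rule nn_integral_eq_integral)
      show "AE s in \<nu>. 0 \<le> (p\<^sub>0 + real n) * (1 / (p\<^sub>0 + real n + s))"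
        using shift by eventually_elim (use p\<^sub>0_pos in auto)
    qed (intro integrable_mult_right stieltjes_integrable, simp)
    then show "(\<integral>\<^sup>+s. ennreal ((p\<^sub>0 + real n) * (1 / (p\<^sub>0 + real n + s))) \<partial>\<nu>) \<le> ennreal B"
      using bound[of n] by (simp add: ennreal_leI)
  qed
  also have "\<dots> < \<infinity>" by (simp add: Liminf_const)
  finally have "emeasure \<nu> (space \<nu>) < \<infinity>" by simp
  then interpret finite_measure \<nu> by (intro finite_measureI) simp
  have "continuous_on {0..} (Lb \<nu>)"
    unfolding continuous_on_sequentially
  proof (intro allI ballI impI, elim conjE)
    fix X t assume X: "\<forall>n. X n \<in> {0::real..}" "X \<longlonglongrightarrow> t"
    from X(2) have "Bseq X" by (meson convergentI convergent_imp_Bseq)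
    then obtain T where T: "\<And>n. \<bar>X n\<bar> \<le> T"
      by (metis Bseq_def real_norm_def)
    have "(\<lambda>n. \<integral>s. exp (- s * X n) \<partial>\<nu>) \<longlonglongrightarrow> (\<integral>s. exp (- s * t) \<partial>\<nu>)"
    proof (rule integral_dominated_convergence[where w="\<lambda>s. exp (p\<^sub>0 * T)"])
      show "AE s in \<nu>. norm (exp (- s * X n)) \<le> exp (p\<^sub>0 * T)" for n
        using AE_ge
      proof eventually_elim
        case (elim s)
        have "- s * X n \<le> p\<^sub>0 * X n" using X(1) elim by (intro mult_right_mono) auto
        also have "\<dots> \<le> p\<^sub>0 * T" using T[of n] p\<^sub>0_pos by (intro mult_left_mono) auto
        finally show ?case by simp
      qed
      show "AE s in \<nu>. (\<lambda>n. exp (- s * X n)) \<longlonglongrightarrow> exp (- s * t)"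
        by (intro AE_I2 tendsto_intros X(2))
    qed auto
    then show "(Lb \<nu> \<circ> X) \<longlonglongrightarrow> Lb \<nu> t" by (simp add: Lb_def o_def)
  qed
  then have "continuous_on {0..} (causal_part (Lb \<nu>))"
    by (rule continuous_on_eq) (auto simp: causal_part_def)
  then show ?thesis by (simp add: causal_cont_def causal_part_def)
qed

end

lemma M_exp_half_line_measure:
  assumes \<nu>: "\<nu> \<in> M_exp 1"
  obtains b where "\<And>p. b \<le> p \<Longrightarrow> half_line_measure \<nu> p"
proof -
  have sets [measurable_cong]: "sets \<nu> = sets borel"
    and loc: "\<And>C. compact C \<Longrightarrow> emeasure \<nu> C < \<infinity>"
    and fin: "(\<integral>\<^sup>+ s. ennreal ((1 + s\<^sup>2) powr (- real 1 / 2)) \<partial>\<nu>) < \<infinity>"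
    and bdd: "bdd_below (measure_support \<nu>)"
    using \<nu> by (auto simp: M_exp_def M_plus_def)
  obtain a where "\<And>s. s \<in> measure_support \<nu> \<Longrightarrow> a \<le> s"
    using bdd by (auto simp: bdd_below_def)
  then have AE_a: "AE s in \<nu>. a \<le> s" by (rule null_below_support[OF sets])
  have sf: "sigma_finite_measure \<nu>"
  proof
    show "\<exists>A. countable A \<and> A \<subseteq> sets \<nu> \<and> \<Union>A = space \<nu> \<and> (\<forall>a\<in>A. emeasure \<nu> a \<noteq> \<infinity>)"
    proof (intro exI[of _ "range (\<lambda>n::nat. {- real n..real n})"] conjI)
      have "x \<in> (\<Union>n. {- real n..real n})" for x
      proof -
        obtain n where "\<bar>x\<bar> \<le> real n" using real_arch_simple by blast
        then show ?thesis by (auto intro!: exI[of _ n])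
      qed
      then show "\<Union> (range (\<lambda>n::nat. {- real n..real n})) = space \<nu>"
        using sets_eq_imp_space_eq[OF sets] by auto
      show "\<forall>a\<in>range (\<lambda>n::nat. {- real n..real n}). emeasure \<nu> a \<noteq> \<infinity>"
        using loc by (auto simp: less_top)
    qed (auto simp: sets)
  qed
  have int: "integrable \<nu> (\<lambda>s. (1 + s\<^sup>2) powr (- 1 / 2))"
  proof (rule integrableI_bounded)
    show "(\<integral>\<^sup>+ s. ennreal (norm ((1 + s\<^sup>2) powr (- 1 / 2))) \<partial>\<nu>) < \<infinity>"
      using fin by simp
  qed measurable
  show thesis
  proof
    \<comment> \<open>For \<open>a \<le> s\<close> one has \<open>\<bar>s\<bar> \<le> s + 2 * \<bar>a\<bar>\<close>, so that \<open>p + s\<close> dominates \<open>1 + \<bar>s\<bar>\<close> and with it \<open>sqrt (1 + s\<^sup>2)\<close>.\<close>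
    fix p assume p: "1 + 2 * \<bar>a\<bar> \<le> p"
    have bound: "1 + \<bar>s\<bar> \<le> p + s" if "a \<le> s" for s using p that by arith
    have "integrable \<nu> (\<lambda>s. 1 / (p + s))"
    proof (rule Bochner_Integration.integrable_bound[OF int])
      show "AE s in \<nu>. norm (1 / (p + s)) \<le> norm ((1 + s\<^sup>2) powr (- 1 / 2))"
        using AE_a
      proof eventually_elim
        case (elim s)
        have "(1 + s\<^sup>2) \<le> (1 + \<bar>s\<bar>)\<^sup>2" by (simp add: power2_sum)
        then have "sqrt (1 + s\<^sup>2) \<le> 1 + \<bar>s\<bar>" by (simp add: real_le_lsqrt)
        then have "sqrt (1 + s\<^sup>2) \<le> p + s" using bound[OF elim] by linarith
        moreover have "0 < sqrt (1 + s\<^sup>2)" by (simp add: add_pos_nonneg)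
        ultimately have "1 / (p + s) \<le> 1 / sqrt (1 + s\<^sup>2)"
          by (intro frac_le) auto
        also have "\<dots> = (1 + s\<^sup>2) powr (- 1 / 2)"
          by (simp add: powr_minus_divide powr_half_sqrt)
        finally show ?case using bound[OF elim] by simp
      qed
    qed measurable
    moreover have "AE s in \<nu>. 1 \<le> p + s"
      using AE_a by eventually_elim (use bound in force)
    ultimately show "half_line_measure \<nu> p"
      using p by (intro half_line_measure.intro[OF sf] half_line_measure_axioms.intro sets) auto
  qed
qed

text \<open>
  The relation \<open>B_R\<close> is stated in the open upper half-plane; it is transported to the real points
  \<open>- p\<close> by continuity, where it becomes an identity between real Laplace transforms.
\<close>

lemma stieltjes_product:
  assumes \<nu>: "half_line_measure \<nu> p" and \<mu>: "half_line_measure \<mu> p"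
    and B: "B_R \<nu> c0 c1 \<mu> \<zeta>0 \<zeta>1"
  shows "(stieltjes \<nu> p + c0 - c1 * p) * (stieltjes \<mu> p + \<zeta>0 - \<zeta>1 * p) = - pi\<^sup>2"
proof -
  define z where "z = (\<lambda>n. Complex (- p) (1 / real (Suc n)))"
  have z_lim: "z \<longlonglongrightarrow> of_real (- p)"
  proof -
    have "z \<longlonglongrightarrow> Complex (- p) 0"
      unfolding z_def 
        by (intro tendsto_Complex tendsto_const one_over_Suc_tendsto_0)
    then show ?thesis by (simp add: Complex_eq)
  qed
  have factor_lim: "(\<lambda>n. Q_R \<rho> (z n) - \<i> / of_real pi * of_real b0 - \<i> / of_real pi * of_real b1 * z n)
      \<longlonglongrightarrow> - (\<i> / of_real pi) * of_real (stieltjes \<rho> p + b0 - b1 * p)"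
    if "half_line_measure \<rho> p" for \<rho> b0 b1
  proof -
    have "(\<lambda>n. Q_R \<rho> (z n) - \<i> / of_real pi * of_real b0 - \<i> / of_real pi * of_real b1 * z n)
      \<longlonglongrightarrow> - (\<i> / of_real pi) * of_real (stieltjes \<rho> p) - \<i> / of_real pi * of_real b0
        - \<i> / of_real pi * of_real b1 * of_real (- p)"
      using half_line_measure.Q_R_boundary_value[OF that order_refl] z_lim unfolding z_def
      by (intro tendsto_intros)
    then show ?thesis by (simp add: algebra_simps)
  qed
  have "(\<lambda>n. (Q_R \<nu> (z n) - \<i> / of_real pi * of_real c0 - \<i> / of_real pi * of_real c1 * z n) *
        (Q_R \<mu> (z n) - \<i> / of_real pi * of_real \<zeta>0 - \<i> / of_real pi * of_real \<zeta>1 * z n))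
     \<longlonglongrightarrow> (- (\<i> / of_real pi) * of_real (stieltjes \<nu> p + c0 - c1 * p)) *
        (- (\<i> / of_real pi) * of_real (stieltjes \<mu> p + \<zeta>0 - \<zeta>1 * p))"
    by (intro tendsto_mult factor_lim \<nu> \<mu>)
  moreover have "Im (z n) > 0" for n by (simp add: z_def)
  ultimately have "(\<lambda>n. 1) \<longlonglongrightarrow> (- (\<i> / of_real pi) * of_real (stieltjes \<nu> p + c0 - c1 * p)) *
        (- (\<i> / of_real pi) * of_real (stieltjes \<mu> p + \<zeta>0 - \<zeta>1 * p))"
    using B by (simp add: B_R_def)
  then have "1 = (- (\<i> / of_real pi) * of_real (stieltjes \<nu> p + c0 - c1 * p)) *
        (- (\<i> / of_real pi) * of_real (stieltjes \<mu> p + \<zeta>0 - \<zeta>1 * p))"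
    using LIMSEQ_unique tendsto_const by blast
  also have "\<dots> = of_real (- ((stieltjes \<nu> p + c0 - c1 * p) * (stieltjes \<mu> p + \<zeta>0 - \<zeta>1 * p)) / pi\<^sup>2)"
    by (simp add: power2_eq_square field_simps)
  finally have "1 = - ((stieltjes \<nu> p + c0 - c1 * p) * (stieltjes \<mu> p + \<zeta>0 - \<zeta>1 * p)) / pi\<^sup>2"
    using of_real_eq_iff[where 'a=complex] of_real_1 by metis
  then show ?thesis by (simp add: field_simps)
qed

section \<open>The integrated operators and their product\<close>

lemma causal_cont_convolve_L1_right:
  "causal_cont f \<Longrightarrow> causal_L1 g \<Longrightarrow> causal_cont (f \<star> g)"
  by (subst convolve_commute) (rule causal_cont_convolve)

lemmas causal_intros =
  causal_cont_zero causal_cont_unit_step causal_cont_add causal_cont_diff causal_cont_scale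
  causal_cont_convolve causal_cont_convolve_L1_right causal_cont_imp_L1

text \<open>
  The operator \<open>x \<mapsto> a * x' - b * x - K \<star> x\<close>, integrated twice, is convolution with this continuous
  function when \<open>x 0 = 0\<close>. Two integrations are needed to turn the derivative of a Dirac mass into a
  function; one would still leave a Dirac mass.
\<close>

definition operator_kernel :: "real \<Rightarrow> real \<Rightarrow> (real \<Rightarrow> real) \<Rightarrow> real \<Rightarrow> real" where
  "operator_kernel a b K =
     (\<lambda>t. a * unit_step t - b * (unit_step \<star> unit_step) t - (unit_step \<star> (unit_step \<star> K)) t)"

lemma causal_cont_operator_kernel:
  "causal_L1 K \<Longrightarrow> causal_cont (operator_kernel a b K)"
  unfolding operator_kernel_def by (simp add: causal_intros)

lemma operator_kernel_convolve:
  assumes K: "causal_L1 K" and f: "causal_cont f"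
  shows "operator_kernel a b K \<star> f = (\<lambda>t. a * (unit_step \<star> f) t
     - b * (unit_step \<star> (unit_step \<star> f)) t - (unit_step \<star> (unit_step \<star> (K \<star> f))) t)"
proof -
  have "f \<star> operator_kernel a b K = (\<lambda>t. a * (f \<star> unit_step) t
      - b * (f \<star> (unit_step \<star> unit_step)) t - (f \<star> (unit_step \<star> (unit_step \<star> K))) t)"
    unfolding operator_kernel_def using K f
    by (simp add: convolve_diff convolve_scale causal_intros)
  moreover have "f \<star> unit_step = unit_step \<star> f" by (rule convolve_commute)
  moreover have "f \<star> (unit_step \<star> unit_step) = unit_step \<star> (unit_step \<star> f)"
    by (subst convolve_commute, subst convolve_assoc) (use f in \<open>simp_all add: causal_intros\<close>)
  moreover have "f \<star> (unit_step \<star> (unit_step \<star> K)) = unit_step \<star> (unit_step \<star> (K \<star> f))"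
  proof -
    have "unit_step \<star> (unit_step \<star> (K \<star> f)) = unit_step \<star> ((unit_step \<star> K) \<star> f)"
      using K f by (subst convolve_assoc) (simp_all add: causal_intros)
    also have "\<dots> = (unit_step \<star> (unit_step \<star> K)) \<star> f"
      using K f by (intro convolve_assoc) (simp_all add: causal_intros)
    finally show ?thesis by (simp add: convolve_commute[of f])
  qed
  ultimately show ?thesis by (subst convolve_commute) simp
qed

lemma laplace_operator_kernel:
  assumes K: "laplace K p v" and p: "0 < p"
  shows "laplace (operator_kernel a b K) p ((a * p - b - v) / p\<^sup>2)"
proof -
  note U = laplace_unit_step[OF p]
  have "laplace (operator_kernel a b K) p
      (a * (1 / p) - b * (1 / p * (1 / p)) - 1 / p * (1 / p * v))"
    unfolding operator_kernel_def
    by (intro laplace_diff laplace_scale laplace_convolve U K)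
  moreover have "a * (1 / p) - b * (1 / p * (1 / p)) - 1 / p * (1 / p * v) = (a * p - b - v) / p\<^sup>2"
    using p by (simp add: field_simps power2_eq_square)
  ultimately show ?thesis by simp
qed

text \<open>
  Both sides are continuous, and by \<open>stieltjes_product\<close> both have the Laplace transform \<open>- pi\<^sup>2 / p ^ 4\<close>.
  The factor \<open>1 / p ^ 4\<close> stems from the two integrations hidden in each kernel; the fourfold
  convolution power of the step accounts for it.
\<close>

lemma operator_kernels_inverse:
  assumes \<nu>: "\<And>p. b \<le> p \<Longrightarrow> half_line_measure \<nu> p"
    and \<mu>: "\<And>p. b \<le> p \<Longrightarrow> half_line_measure \<mu> p"
    and B: "B_R \<nu> c0 c1 \<mu> \<zeta>0 \<zeta>1"
  shows "operator_kernel \<zeta>1 \<zeta>0 (causal_part (Lb \<mu>)) \<star> operator_kernel c1 c0 (causal_part (Lb \<nu>))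
     = (\<lambda>t. - pi\<^sup>2 * (unit_step \<star> (unit_step \<star> (unit_step \<star> unit_step))) t)"
    (is "?j \<star> ?k = (\<lambda>t. - pi\<^sup>2 * ?u t)")
proof -
  have "(\<lambda>t. (?j \<star> ?k) t + pi\<^sup>2 * ?u t) = (\<lambda>t. 0)"
  proof (rule Lerch[where b=b])
    show "causal_cont (\<lambda>t. (?j \<star> ?k) t + pi\<^sup>2 * ?u t)"
      using half_line_measure.causal_L1_Lb[OF \<nu>[OF order_refl]]
        half_line_measure.causal_L1_Lb[OF \<mu>[OF order_refl]]
      by (simp add: causal_intros causal_cont_operator_kernel)
    fix p assume p: "b \<le> p"
    have p_pos: "0 < p" using half_line_measure.p\<^sub>0_pos[OF \<nu>[OF p]] .
    note U = laplace_unit_step[OF p_pos]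
    have k: "laplace ?k p ((c1 * p - c0 - stieltjes \<nu> p) / p\<^sup>2)"
      by (rule laplace_operator_kernel[OF half_line_measure.laplace_Lb[OF \<nu>[OF p] order_refl] p_pos])
    have j: "laplace ?j p ((\<zeta>1 * p - \<zeta>0 - stieltjes \<mu> p) / p\<^sup>2)"
      by (rule laplace_operator_kernel[OF half_line_measure.laplace_Lb[OF \<mu>[OF p] order_refl] p_pos])
    have "laplace (\<lambda>t. (?j \<star> ?k) t + pi\<^sup>2 * ?u t) p
        ((\<zeta>1 * p - \<zeta>0 - stieltjes \<mu> p) / p\<^sup>2 * ((c1 * p - c0 - stieltjes \<nu> p) / p\<^sup>2)
          + pi\<^sup>2 * (1 / p * (1 / p * (1 / p * (1 / p)))))"
      by (intro laplace_add laplace_scale laplace_convolve U k j)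
    moreover have "(\<zeta>1 * p - \<zeta>0 - stieltjes \<mu> p) / p\<^sup>2 * ((c1 * p - c0 - stieltjes \<nu> p) / p\<^sup>2)
          = - pi\<^sup>2 / p ^ 4"
    proof -
      have "(\<zeta>1 * p - \<zeta>0 - stieltjes \<mu> p) * (c1 * p - c0 - stieltjes \<nu> p)
          = (stieltjes \<nu> p + c0 - c1 * p) * (stieltjes \<mu> p + \<zeta>0 - \<zeta>1 * p)"
        by (simp add: algebra_simps)
      also have "\<dots> = - pi\<^sup>2" by (rule stieltjes_product[OF \<nu>[OF p] \<mu>[OF p] B])
      finally show ?thesis by (simp only: times_divide_times_eq) (simp flip: power_add)
    qed
    moreover have "- pi\<^sup>2 / p ^ 4 + pi\<^sup>2 * (1 / p * (1 / p * (1 / p * (1 / p)))) = 0"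
      using p_pos by (simp add: field_simps power4_eq_xxxx)
    ultimately show "laplace (\<lambda>t. (?j \<star> ?k) t + pi\<^sup>2 * ?u t) p 0" by simp
  qed
  then show ?thesis by (auto simp: fun_eq_iff add_eq_0_iff)
qed

text \<open>
  If the first symbol grows like \<open>- c1 * q\<close>, then the second is \<open>- C / (c1 * q)\<close> to leading order, which
  leaves no room for a constant or a linear term and determines the size of \<open>r\<close>.
\<close>

lemma asymptotics_of_inverse_symbol:
  fixes q s r :: "nat \<Rightarrow> real"
  assumes q: "filterlim q at_top sequentially" and s: "s \<longlonglongrightarrow> 0" and r: "r \<longlonglongrightarrow> 0"
    and prod: "\<And>n. (s n + c0 - c1 * q n) * (r n + d0 - d1 * q n) = C"
    and c1: "c1 \<noteq> 0"
  shows "d1 = 0" "d0 = 0" "Bseq (\<lambda>n. q n * r n)"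
proof -
  have inv: "(\<lambda>n. a / q n) \<longlonglongrightarrow> 0" for a
    by (intro tendsto_divide_0[OF tendsto_const] filterlim_at_top_imp_at_infinity q)
  have q_pos: "\<forall>\<^sub>F n in sequentially. 0 < q n"
    using q by (auto simp: filterlim_at_top_dense)
  \<comment> \<open>\<open>A n\<close> is the first symbol divided by \<open>q n\<close>.\<close>
  define A where "A = (\<lambda>n. s n * (1 / q n) + c0 / q n - c1)"
  have A: "A \<longlonglongrightarrow> - c1"
  proof -
    have "A \<longlonglongrightarrow> 0 * 0 + 0 - c1"
      unfolding A_def by (intro tendsto_intros s inv)
    then show ?thesis by simp
  qed
  have A_nz: "\<forall>\<^sub>F n in sequentially. A n \<noteq> 0"
    using tendsto_imp_eventually_ne[OF A] c1 by simp
  have solve: "\<forall>\<^sub>F n in sequentially. (r n + d0 - d1 * q n) * q n = C / A n"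
    using q_pos A_nz
  proof eventually_elim
    case (elim n)
    have "A n * q n = s n + c0 - c1 * q n" using elim by (simp add: A_def field_simps)
    then have "A n * ((r n + d0 - d1 * q n) * q n) = C"
      using prod[of n] by (metis mult.assoc mult.commute)
    then show ?case using elim by (simp add: field_simps)
  qed
  have CA: "(\<lambda>n. C / A n) \<longlonglongrightarrow> C / (- c1)"
    using A c1 by (intro tendsto_intros) auto
  have "(\<lambda>n. C / A n * (1 / q n)) \<longlonglongrightarrow> C / (- c1) * 0"
    by (intro tendsto_mult CA inv)
  moreover have "\<forall>\<^sub>F n in sequentially. C / A n * (1 / q n) = r n + d0 - d1 * q n"
    using solve q_pos
  proof eventually_elim
    case (elim n)
    have "C / A n * (1 / q n) = (r n + d0 - d1 * q n) * q n * (1 / q n)"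
      by (simp only: elim(1))
    then show ?case using elim(2) by simp
  qed
  ultimately have "(\<lambda>n. r n + d0 - d1 * q n) \<longlonglongrightarrow> 0"
    by (auto intro: Lim_transform_eventually)
  from tendsto_diff[OF this r] have d: "(\<lambda>n. d0 - d1 * q n) \<longlonglongrightarrow> 0" by simp
  have "(\<lambda>n. d0 * (1 / q n) - (d0 - d1 * q n) * (1 / q n)) \<longlonglongrightarrow> d0 * 0 - 0 * 0"
    by (intro tendsto_intros d inv)
  moreover have "\<forall>\<^sub>F n in sequentially. d0 * (1 / q n) - (d0 - d1 * q n) * (1 / q n) = d1"
    using q_pos by eventually_elim (simp add: field_simps)
  ultimately have "(\<lambda>n. d1) \<longlonglongrightarrow> 0"
    by (auto intro: Lim_transform_eventually)
  then show d1: "d1 = 0" by (simp add: LIMSEQ_const_iff)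
  show d0: "d0 = 0" using d d1 by (simp add: LIMSEQ_const_iff)
  have "\<forall>\<^sub>F n in sequentially. C / A n = q n * r n"
    using solve d0 d1 by (auto elim!: eventually_mono simp: mult.commute)
  with CA have "(\<lambda>n. q n * r n) \<longlonglongrightarrow> C / (- c1)" by (rule Lim_transform_eventually)
  then show "Bseq (\<lambda>n. q n * r n)" by (meson convergentI convergent_imp_Bseq)
qed

text \<open>
  The term \<open>c1 * x0 * J t\<close> of the solution formula can be nonzero only in the case treated here. Then
  \<open>\<mu>\<close> is finite, so \<open>J\<close> has no singularity at \<open>0\<close> and the formula is meaningful at \<open>t = 0\<close> too.
\<close>

lemma derivative_term_excludes_inverse_derivative:
  assumes \<nu>: "\<And>p. b \<le> p \<Longrightarrow> half_line_measure \<nu> p"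
    and \<mu>: "\<And>p. b \<le> p \<Longrightarrow> half_line_measure \<mu> p"
    and B: "B_R \<nu> c0 c1 \<mu> \<zeta>0 \<zeta>1" and c1: "c1 \<noteq> 0"
  shows "\<zeta>1 = 0" "\<zeta>0 = 0" "causal_cont (causal_part (Lb \<mu>))"
proof -
  interpret \<nu>: half_line_measure \<nu> b using \<nu> by simp
  interpret \<mu>: half_line_measure \<mu> b using \<mu> by simp
  have q: "filterlim (\<lambda>n. b + real n) at_top sequentially"
    by (rule filterlim_tendsto_add_at_top[OF tendsto_const filterlim_real_sequentially])
  note asym = asymptotics_of_inverse_symbol[OF q \<nu>.stieltjes_tendsto_0 \<mu>.stieltjes_tendsto_0
      stieltjes_product[OF \<nu> \<mu> B] c1, simplified]
  show "\<zeta>1 = 0" "\<zeta>0 = 0" by (fact asym(1), fact asym(2))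
  obtain M where M: "\<And>n. norm ((b + real n) * stieltjes \<mu> (b + real n)) \<le> M"
    using asym(3) by (auto simp: Bseq_def)
  then show "causal_cont (causal_part (Lb \<mu>))"
    by (intro \<mu>.causal_cont_Lb[of M]) (use abs_le_D1 in auto)
qed

section \<open>Inverting the equation\<close>

text \<open>
  Let \<open>U\<close> be the unit step, \<open>k\<close> and \<open>j\<close> the two operator kernels. Integrating the equation twice gives
  \<open>U \<star> (U \<star> y) = k \<star> u - c1 * x0 * (U \<star> U)\<close>. Convolving with \<open>j\<close> and inserting the value of \<open>j \<star> k\<close>
  produces on the right a term with four integrations of \<open>u\<close>; cancelling three of these common
  integrations leaves an equation for the primitive of \<open>F\<close>.
  
  The conclusion is the solution formula integrated once. In this form it does not presuppose that
  \<open>y\<close> is differentiable: if \<open>\<zeta>1\<close> is nonzero, differentiability of \<open>y\<close> is read off from it.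
  The function \<open>v\<close> stands for \<open>c1 * u'\<close>; it is continuous also when \<open>c1 = 0\<close> and \<open>u'\<close> need not exist.
\<close>

lemma convolve_inversion:
  assumes K: "causal_L1 K" and J: "causal_L1 J" and u: "causal_cont u" and v: "causal_cont v"
    and v_int: "unit_step \<star> v = (\<lambda>t. c1 * u t - c1 * x0 * unit_step t)"
    and y_eq: "y = (\<lambda>t. v t - c0 * u t - (K \<star> u) t)"
    and inverse: "operator_kernel \<zeta>1 \<zeta>0 J \<star> operator_kernel c1 c0 K
       = (\<lambda>t. - pi\<^sup>2 * (unit_step \<star> (unit_step \<star> (unit_step \<star> unit_step))) t)"
    and coeff: "c1 \<noteq> 0 \<Longrightarrow> \<zeta>1 = 0 \<and> \<zeta>0 = 0 \<and> causal_cont J"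
  obtains F where "causal_cont F" "causal_cont y"
    "F = (\<lambda>t. \<zeta>0 * y t + (J \<star> y) t - pi\<^sup>2 * u t + c1 * x0 * J t)"
    "(\<lambda>t. \<zeta>1 * y t) = unit_step \<star> F"
proof -
  let ?U = unit_step
  let ?k = "operator_kernel c1 c0 K" and ?j = "operator_kernel \<zeta>1 \<zeta>0 J"
  note cont = causal_intros causal_cont_operator_kernel K J u v
  have y: "causal_cont y" unfolding y_eq by (intro cont)
  define J' where "J' = (\<lambda>t. c1 * x0 * J t)"
  \<comment> \<open>When \<open>c1 = 0\<close> the kernel \<open>J\<close> may be singular at \<open>0\<close>, but then \<open>J'\<close> is the zero function.\<close>
  have J': "causal_cont J'"
    by (cases "c1 = 0") (use coeff in \<open>auto simp: J'_def intro: causal_intros\<close>)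
  define F where "F = (\<lambda>t. \<zeta>0 * y t + (J \<star> y) t - pi\<^sup>2 * u t + J' t)"
  have F: "causal_cont F" unfolding F_def by (intro cont y J')
  have "?U \<star> y = (\<lambda>t. c1 * u t - c1 * x0 * ?U t - c0 * (?U \<star> u) t - (?U \<star> (K \<star> u)) t)"
    unfolding y_eq by (simp add: convolve_diff convolve_scale v_int cont)
  then have "?U \<star> (?U \<star> y) = (\<lambda>t. c1 * (?U \<star> u) t - c1 * x0 * (?U \<star> ?U) t
      - c0 * (?U \<star> (?U \<star> u)) t - (?U \<star> (?U \<star> (K \<star> u))) t)"
    by (simp add: convolve_diff convolve_scale cont)
  then have UUy: "?U \<star> (?U \<star> y) = (\<lambda>t. (?k \<star> u) t - c1 * x0 * (?U \<star> ?U) t)"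
    by (simp add: operator_kernel_convolve cont fun_eq_iff)
  have slide: "?j \<star> (?U \<star> f) = ?U \<star> (?j \<star> f)" if "causal_cont f" for f
  proof -
    have "?j \<star> (?U \<star> f) = (?j \<star> ?U) \<star> f"
      using that by (intro convolve_assoc) (simp_all add: cont)
    also have "\<dots> = ?U \<star> (?j \<star> f)"
      unfolding convolve_commute[of ?j ?U]
      using that by (intro convolve_assoc[symmetric]) (simp_all add: cont)
    finally show ?thesis .
  qed
  have jku: "?j \<star> (?k \<star> u) = (\<lambda>t. - pi\<^sup>2 * (?U \<star> (?U \<star> (?U \<star> (?U \<star> u)))) t)"
  proof -
    have "?j \<star> (?k \<star> u) = (?j \<star> ?k) \<star> u"
      by (intro convolve_assoc) (simp_all add: cont)
    also have "\<dots> = (\<lambda>t. - pi\<^sup>2 * ((?U \<star> (?U \<star> (?U \<star> ?U))) \<star> u) t)"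
      unfolding inverse by (simp add: convolve_commute[of _ u] convolve_scale[of u "- pi\<^sup>2", simplified])
    also have "(?U \<star> (?U \<star> (?U \<star> ?U))) \<star> u = ?U \<star> (?U \<star> (?U \<star> (?U \<star> u)))"
    proof -
      have step: "(?U \<star> f) \<star> u = ?U \<star> (f \<star> u)" if "causal_cont f" for f
        using that by (intro convolve_assoc[symmetric]) (simp_all add: cont)
      show ?thesis by (simp add: step cont)
    qed
    finally show ?thesis .
  qed
  have "?U \<star> (?U \<star> (?j \<star> y)) = ?j \<star> (?U \<star> (?U \<star> y))"
    using y by (simp add: slide cont)
  also have "\<dots> = (\<lambda>t. (?j \<star> (?k \<star> u)) t - c1 * x0 * (?j \<star> (?U \<star> ?U)) t)"
    unfolding UUy by (simp add: convolve_diff convolve_scale cont)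
  also have "\<dots> = ?U \<star> (?U \<star> (\<lambda>t. - pi\<^sup>2 * (?U \<star> (?U \<star> u)) t - c1 * x0 * ?j t))"
  proof -
    have "?j \<star> (?U \<star> ?U) = ?U \<star> (?U \<star> ?j)"
      by (simp add: slide cont convolve_commute[of ?j ?U])
    moreover have "?U \<star> (?U \<star> (\<lambda>t. - pi\<^sup>2 * (?U \<star> (?U \<star> u)) t - c1 * x0 * ?j t)) =
       (\<lambda>t. - pi\<^sup>2 * (?U \<star> (?U \<star> (?U \<star> (?U \<star> u)))) t - c1 * x0 * (?U \<star> (?U \<star> ?j)) t)"
      by (simp only: convolve_diff convolve_scale cont)
    ultimately show ?thesis by (simp only: jku)
  qed
  finally have "?U \<star> (?U \<star> (?j \<star> y)) = \<dots>" .
  then have "?U \<star> (?j \<star> y) = ?U \<star> (\<lambda>t. - pi\<^sup>2 * (?U \<star> (?U \<star> u)) t - c1 * x0 * ?j t)"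
    by (rule step_convolve_cancel[rotated 2]) (intro cont y)+
  then have jy: "?j \<star> y = (\<lambda>t. - pi\<^sup>2 * (?U \<star> (?U \<star> u)) t - c1 * x0 * ?j t)"
    by (rule step_convolve_cancel[rotated 2]) (intro cont y)+
  \<comment> \<open>The terms of \<open>j\<close> with \<open>\<zeta>1\<close> and \<open>\<zeta>0\<close> disappear, as \<open>c1 * \<zeta>1 = c1 * \<zeta>0 = 0\<close>.\<close>
  have "(\<lambda>t. c1 * x0 * ?j t) = (\<lambda>t. - (?U \<star> (?U \<star> J')) t)"
    unfolding J'_def convolve_scale operator_kernel_def
    by (cases "c1 = 0") (use coeff in \<open>auto simp: fun_eq_iff\<close>)
  then have "c1 * x0 * ?j t = - (?U \<star> (?U \<star> J')) t" for t by (rule fun_cong)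
  with jy have jy': "(?j \<star> y) t = - pi\<^sup>2 * (?U \<star> (?U \<star> u)) t + (?U \<star> (?U \<star> J')) t" for t
    by simp
  have "?U \<star> (\<lambda>t. \<zeta>1 * y t) = ?U \<star> (?U \<star> F)"
  proof
    fix t
    have "(?U \<star> (?U \<star> F)) t = \<zeta>0 * (?U \<star> (?U \<star> y)) t + (?U \<star> (?U \<star> (J \<star> y))) t
        - pi\<^sup>2 * (?U \<star> (?U \<star> u)) t + (?U \<star> (?U \<star> J')) t"
      unfolding F_def by (simp only: convolve_diff convolve_add convolve_scale cont y J')
    also have "\<dots> = \<zeta>1 * (?U \<star> y) t"
      using jy'[of t] by (simp add: operator_kernel_convolve[OF J y])
    finally show "(?U \<star> (\<lambda>t. \<zeta>1 * y t)) t = (?U \<star> (?U \<star> F)) t"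
      by (simp add: convolve_scale)
  qed
  then have "(\<lambda>t. \<zeta>1 * y t) = ?U \<star> F"
    by (rule step_convolve_cancel[rotated 2]) (intro cont y F)+
  with F y show thesis by (intro that[of F]) (auto simp: F_def J'_def)
qed

lemma ddt_eqI:
  assumes "(f has_vector_derivative d) (at t within {0..})" "0 \<le> t"
  shows "ddt f t = d"
  unfolding ddt_def
  by (rule vector_derivative_within[OF at_within_half_line_nontrivial[OF assms(2)] assms(1)])

lemma causal_cont_causal_part:
  assumes "continuous_on {0..} f"
  shows "causal_cont (causal_part f)"
proof -
  have "continuous_on {0..} (causal_part f)"
    by (rule continuous_on_eq[OF assms]) (simp add: causal_part_def)
  then show ?thesis by (simp add: causal_cont_def causal_part_def)
qed

text \<open>
  The two integrands can differ only at \<open>\<tau> = t\<close>, where a kernel is evaluated at \<open>0\<close>.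
\<close>

lemma conv_eq_convolve:
  assumes "\<And>t. 0 < t \<Longrightarrow> K t = L t" "0 \<le> t"
  shows "conv K x t = (causal_part L \<star> causal_part x) t"
  unfolding conv_def convolve_def set_lebesgue_integral_def
proof (rule integral_discrete_difference[where X="{t}"])
  fix \<tau> :: real assume "\<tau> \<notin> {t}"
  then consider "\<tau> < 0" | "0 \<le> \<tau>" "\<tau> < t" | "t < \<tau>" by force
  then show "indicat_real {0..t} \<tau> *\<^sub>R (K (t - \<tau>) * x \<tau>)
      = causal_part L (t - \<tau>) * causal_part x \<tau>"
    by cases (use assms in \<open>auto simp: causal_part_def\<close>)
qed auto

lemma step_convolve_ddt:
  assumes diff: "u differentiable_on {0..}" and cont: "continuous_on {0..} (ddt u)"
  shows "unit_step \<star> causal_part (ddt u) = (\<lambda>t. causal_part u t - u 0 * unit_step t)"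
proof
  fix t
  have cc: "causal_cont (causal_part (ddt u))" by (rule causal_cont_causal_part[OF cont])
  show "(unit_step \<star> causal_part (ddt u)) t = causal_part u t - u 0 * unit_step t"
  proof (cases "0 \<le> t")
    case True
    have "(ddt u has_integral (u t - u 0)) {0..t}"
    proof (rule fundamental_theorem_of_calculus[OF True])
      fix s assume s: "s \<in> {0..t}"
      then have "u differentiable (at s within {0..})"
        using diff by (auto simp: differentiable_on_def)
      then have "(u has_vector_derivative ddt u s) (at s within {0..})"
        unfolding ddt_def by (simp add: vector_derivative_works)
      then show "(u has_vector_derivative ddt u s) (at s within {0..t})"
        by (rule has_vector_derivative_within_subset) auto
    qed
    then have "integral {0..t} (ddt u) = u t - u 0" by (rule integral_unique)
    moreover have "integral {0..t} (causal_part (ddt u)) = integral {0..t} (ddt u)"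
      by (rule Henstock_Kurzweil_Integration.integral_cong) (simp add: causal_part_def)
    ultimately have "(unit_step \<star> causal_part (ddt u)) t = u t - u 0"
      by (simp add: step_convolve_eq_integral[OF cc])
    then show ?thesis using True by (simp add: causal_part_def unit_step_def)
  next
    case False
    then have "(unit_step \<star> causal_part (ddt u)) t = 0"
      by (simp add: step_convolve_eq_integral[OF cc])
    then show ?thesis using False by (simp add: causal_part_def unit_step_def)
  qed
qed

lemma classical_solution_cong:
  assumes u: "classical_solution K c0 c1 x0 y u" and eq: "\<And>t. 0 \<le> t \<Longrightarrow> x t = u t"
  shows "classical_solution K c0 c1 x0 y x"
proof -
  have ddt: "ddt x t = ddt u t" if "0 \<le> t" for t
  proof -
    have "(x has_vector_derivative d) (at t within {0..}) \<longleftrightarrow>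
        (u has_vector_derivative d) (at t within {0..})" for d
      using has_vector_derivative_transform[of t "{0..}" x u d]
        has_vector_derivative_transform[of t "{0..}" u x d] eq that by auto
    then show ?thesis by (simp add: ddt_def vector_derivative_def)
  qed
  have integrand: "indicat_real {0..t} \<tau> *\<^sub>R (K (t - \<tau>) * x \<tau>)
      = indicat_real {0..t} \<tau> *\<^sub>R (K (t - \<tau>) * u \<tau>)" for t \<tau>
    using eq by (auto simp: indicator_def)
  have "continuous_on {0..} x = continuous_on {0..} u"
    "continuous_on {0..} (ddt x) = continuous_on {0..} (ddt u)"
    using eq ddt by (auto intro!: continuous_on_cong)
  moreover have "x differentiable_on {0..}" if "u differentiable_on {0..}"
    using that eq unfolding differentiable_on_def
    by (metis atLeast_iff differentiable_transform_within zero_less_one)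
  moreover have "conv K x t = conv K u t" for t
    unfolding conv_def set_lebesgue_integral_def integrand ..
  moreover have "set_integrable lborel {0..t} (\<lambda>\<tau>. K (t - \<tau>) * x \<tau>) \<longleftrightarrow>
      set_integrable lborel {0..t} (\<lambda>\<tau>. K (t - \<tau>) * u \<tau>)" for t
    unfolding set_integrable_def integrand ..
  ultimately show ?thesis
    using u eq ddt by (simp add: classical_solution_def classically_regular_def)
qed

text \<open>
  The function \<open>x\<close> is not inserted into the equation. It is shown to coincide on the half-line
  with the solution \<open>u\<close> whose existence the regularity of \<open>y\<close> asserts.
\<close>

theorem proposition4p6:
  fixes K J x y :: "real \<Rightarrow> real"
    and lam mu :: "real measure"
    and c0 c1 \<zeta>0 \<zeta>1 x0 :: real
  assumes "K \<in> {0<..} \<rightarrow> {0..}"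
    and "gCM K"
    and "is_Lb_inverse lam K"
    and "lam \<in> M_exp 1"
    and "c1 \<ge> 0"
    and y_regular: "\<exists>u. classical_solution K c0 c1 x0 y u"
    and "B_R lam c0 c1 mu \<zeta>0 \<zeta>1"
    and "mu \<in> M_exp 1"
    and "J = Lb mu"
    and x_formula: "\<forall>t\<ge>0. - pi\<^sup>2 * x t = \<zeta>1 * ddt y t - \<zeta>0 * y t - conv J y t - c1 * x0 * J t"
  shows "classically_regular \<zeta>1 J y \<and> classical_solution K c0 c1 x0 y x"
proof -
  obtain u where u: "classical_solution K c0 c1 x0 y u" using y_regular by blast
  obtain b\<^sub>1 where b\<^sub>1: "\<And>p. b\<^sub>1 \<le> p \<Longrightarrow> half_line_measure lam p"
    using M_exp_half_line_measure[OF \<open>lam \<in> M_exp 1\<close>] by blast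
  obtain b\<^sub>2 where b\<^sub>2: "\<And>p. b\<^sub>2 \<le> p \<Longrightarrow> half_line_measure mu p"
    using M_exp_half_line_measure[OF \<open>mu \<in> M_exp 1\<close>] by blast
  define b where "b = max b\<^sub>1 b\<^sub>2"
  have lam: "half_line_measure lam p" and mu: "half_line_measure mu p" if "b \<le> p" for p
    using that b\<^sub>1 b\<^sub>2 by (auto simp: b_def)
  let ?K = "causal_part (Lb lam)" and ?J = "causal_part (Lb mu)"
  let ?u = "causal_part u" and ?y = "causal_part y"
  have K: "causal_L1 ?K" and J: "causal_L1 ?J"
    using half_line_measure.causal_L1_Lb lam mu order_refl by blast+
  have u_cont: "continuous_on {0..} u" and
    y_eq: "\<And>t. 0 \<le> t \<Longrightarrow> y t = c1 * ddt u t - c0 * u t - conv K u t"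
    using u by (auto simp: classical_solution_def classically_regular_def)
  have uc: "causal_cont ?u" by (rule causal_cont_causal_part[OF u_cont])
  define v where "v = (\<lambda>t. c1 * causal_part (ddt u) t)"
  have v: "causal_cont v"
    and v_int: "unit_step \<star> v = (\<lambda>t. c1 * ?u t - c1 * x0 * unit_step t)"
  proof -
    show "causal_cont v"
      unfolding v_def using u
      by (cases "c1 = 0") (auto simp: classical_solution_def classically_regular_def
          intro!: causal_intros causal_cont_causal_part)
    show "unit_step \<star> v = (\<lambda>t. c1 * ?u t - c1 * x0 * unit_step t)"
    proof (cases "c1 = 0")
      case True
      then show ?thesis by (simp add: v_def convolve_def fun_eq_iff)
    next
      case False
      then have "unit_step \<star> causal_part (ddt u) = (\<lambda>t. ?u t - x0 * unit_step t)"
        using u step_convolve_ddt[of u]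
        by (simp add: classical_solution_def classically_regular_def)
      then show ?thesis by (simp add: v_def convolve_scale algebra_simps)
    qed
  qed
  have conv_K: "conv K u t = (?K \<star> ?u) t" if "0 \<le> t" for t
    using that \<open>is_Lb_inverse lam K\<close> by (intro conv_eq_convolve) (auto simp: is_Lb_inverse_def)
  have conv_J: "conv J y t = (?J \<star> ?y) t" if "0 \<le> t" for t
    using that \<open>J = Lb mu\<close> by (intro conv_eq_convolve) auto
  have y_fun: "?y = (\<lambda>t. v t - c0 * ?u t - (?K \<star> ?u) t)"
  proof
    fix t
    have "causal_cont (?K \<star> ?u)" by (rule causal_cont_convolve[OF K uc])
    then show "?y t = v t - c0 * ?u t - (?K \<star> ?u) t"
      using y_eq[of t] conv_K[of t]
      by (cases "0 \<le> t") (auto simp: causal_part_def v_def causal_cont_def)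
  qed
  \<comment> \<open>If \<open>c1 = 0\<close>, the term with \<open>J t\<close> drops out of the formula for \<open>x\<close>, also at \<open>t = 0\<close>.\<close>
  have coeff: "\<zeta>1 = 0 \<and> \<zeta>0 = 0 \<and> causal_cont ?J" if "c1 \<noteq> 0"
    using derivative_term_excludes_inverse_derivative[OF lam mu \<open>B_R lam c0 c1 mu \<zeta>0 \<zeta>1\<close> that]
    by blast
  obtain F where F: "causal_cont F" and yc: "causal_cont ?y"
    and F_eq: "F = (\<lambda>t. \<zeta>0 * ?y t + (?J \<star> ?y) t - pi\<^sup>2 * ?u t + c1 * x0 * ?J t)"
    and y_F: "(\<lambda>t. \<zeta>1 * ?y t) = unit_step \<star> F"
    by (rule convolve_inversion[OF K J uc v v_int y_fun
          operator_kernels_inverse[OF lam mu \<open>B_R lam c0 c1 mu \<zeta>0 \<zeta>1\<close>] coeff])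
  have y_deriv: "(y has_vector_derivative F t / \<zeta>1) (at t within {0..})"
    if "\<zeta>1 \<noteq> 0" "0 \<le> t" for t
  proof -
    have "((\<lambda>t. (1 / \<zeta>1) * (unit_step \<star> F) t) has_vector_derivative (1 / \<zeta>1) * F t) (at t within {0..})"
      by (intro has_vector_derivative_mult_right step_convolve_has_derivative F that)
    then show ?thesis
      by (rule has_vector_derivative_transform[rotated 2, THEN has_vector_derivative_eq_rhs])
        (use that in \<open>auto simp: y_F[symmetric] causal_part_def\<close>)
  qed
  have ddt_y: "\<zeta>1 * ddt y t = F t" if "0 \<le> t" for t
  proof (cases "\<zeta>1 = 0")
    case True
    then have "unit_step \<star> F = unit_step \<star> (\<lambda>t. 0)"
      using y_F by (simp add: convolve_def fun_eq_iff)
    then have "F = (\<lambda>t. 0)" by (rule step_convolve_cancel[OF F causal_cont_zero])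
    then show ?thesis using True by simp
  next
    case False
    then show ?thesis using ddt_eqI[OF y_deriv] that by simp
  qed
  have "x t = u t" if t: "0 \<le> t" for t
  proof -
    have "- pi\<^sup>2 * x t = F t - \<zeta>0 * y t - (?J \<star> ?y) t - c1 * x0 * ?J t"
      using x_formula t ddt_y[OF t] conv_J[OF t] \<open>J = Lb mu\<close> by (simp add: causal_part_def)
    also have "\<dots> = - pi\<^sup>2 * u t"
      using t by (simp add: F_eq causal_part_def)
    finally show ?thesis by simp
  qed
  then have sol: "classical_solution K c0 c1 x0 y x"
    by (rule classical_solution_cong[OF u])
  have "classically_regular \<zeta>1 J y"
    unfolding classically_regular_def
  proof (intro conjI impI allI)
    have "continuous_on {0..} ?y" using yc by (simp add: causal_cont_def)
    then show "continuous_on {0..} y"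
      by (rule continuous_on_eq) (simp add: causal_part_def)
    assume nz: "\<zeta>1 \<noteq> 0"
    show "y differentiable_on {0..}"
      unfolding differentiable_on_def
      using y_deriv[OF nz] by (auto intro: differentiableI_vector)
    have "continuous_on {0..} (\<lambda>t. F t / \<zeta>1)"
      using F nz by (intro continuous_intros) (auto simp: causal_cont_def)
    then show "continuous_on {0..} (ddt y)"
      by (rule continuous_on_eq) (use ddt_y nz in \<open>auto simp: field_simps\<close>)
  next
    fix t :: real assume "0 \<le> t"
    have "integrable lborel (\<lambda>\<tau>. ?J (t - \<tau>) * ?y \<tau>)"
      by (rule convolve_integrand_integrable[OF J yc])
    moreover have "?J (t - \<tau>) * ?y \<tau> = indicat_real {0..t} \<tau> *\<^sub>R (J (t - \<tau>) * y \<tau>)" for \<tau>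
      by (auto simp: causal_part_def \<open>J = Lb mu\<close> indicator_def)
    ultimately show "set_integrable lborel {0..t} (\<lambda>\<tau>. J (t - \<tau>) * y \<tau>)"
      by (simp add: set_integrable_def)
  qed
  with sol show ?thesis by blast
qed

end
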